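(* Let $V=\mathbb{Z}$, let $a(\cdot,\cdot)$ be the nearest neighbor random walk kernel, and let $X=(X_t)_{t\ge0}$ be the cooperative Voter Model with Bias and Cooperation (cVMBC) on $\mathbb{Z}$ with parameters $\alpha,\gamma\geq 0$. Let $X_0$ contain either finitely many defectors or finitely many cooperators (i.e. $X_0=\mathbf{1}_A$ or $X_0=1-\mathbf{1}_A$ for some finite $A\subseteq V$). Then: (i) The process clusters. (ii) If $\alpha\geq\gamma$ and $X_0$ contains finitely many cooperators, the cooperators (type 1) die out. (iii) If $\gamma\geq\alpha$ and $X_0$ contains finitely many defectors, the defectors (type 0) die out.
   Context: Kernels. On $V=\mathbb{Z}$ the nearest neighbor random walk kernel is $a(u,v)=\frac12$ if $|u-v|=1$ and $a(u,v)=0$ otherwise. The cooperation kernel of the cVMBC is $b(u,(v,w))=\frac12\mathbf{1}_{\{u\neq w\}}$ if $|u-v|=|w-v|=1$, and $b(u,(v,w))=0$ otherwise. Process. The cVMBC with parameters $\alpha,\gamma\ge 0$ is the (unique) Markov process (spin system) $X=(X_t)_{t\ge0}$ with state space $\{0,1\}^V$ in which, when the current configuration is $X$, the value at site $u$ flips from $X(u)$ to $1-X(u)$ at rate $c(u,X)$, where: if $X(u)=0$, then $c(u,X)=\sum_{v} a(v,u)X(v)+\gamma\sum_{v}X(v)\sum_{w}X(w)\,b(w,(v,u))$; if $X(u)=1$, then $c(u,X)=(1+\alpha)\sum_{v} a(v,u)(1-X(v))+\gamma\sum_{v}(1-X(v))\sum_{w}X(w)\,b(w,(v,u))$. Sites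 with value 0 carry defectors, sites with value 1 carry cooperators. Long-time behavior. Type $i\in\{0,1\}$ dies out if $P(\lim_{t\to\infty}X_t(u)=1-i)=1$ for all $u\in V$. The process clusters if $\lim_{t\to\infty}P(X_t(u)=X_t(v))=1$ for all $u,v\in V$. *)

theory Defs
  imports "HOL-Probability.Probability"
begin

text \<open>
  A configuration in \<open>{0,1}\<^sup>V\<close> is a function \<open>'v \<Rightarrow> bool\<close>, where \<^const>\<open>True\<close> stands for 1 and
  \<^const>\<open>False\<close> for 0. The library topology on this function type is the product of the discrete
  topologies, so it is compact, and \<open>'v config \<Rightarrow>\<^sub>C real\<close> with its supremum norm is the
  Banach space of all continuous functions on \<open>{0,1}\<^sup>V\<close>.
\<close>

type_synonym 'v config = "'v \<Rightarrow> bool"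

definition flip :: "'v \<Rightarrow> 'v config \<Rightarrow> 'v config" where
  "flip u \<eta> = \<eta>(u := \<not> \<eta> u)"

definition cylinder :: "('v config \<Rightarrow> real) \<Rightarrow> bool" where
  "cylinder f \<longleftrightarrow> (\<exists>S. finite S \<and> (\<forall>\<eta> \<zeta>. (\<forall>u\<in>S. \<eta> u = \<zeta> u) \<longrightarrow> f \<eta> = f \<zeta>))"

text \<open>For a cylinder function \<open>f\<close> only finitely many terms of the following sum are nonzero.\<close>

definition spin_pregenerator ::
    "('v \<Rightarrow> 'v config \<Rightarrow> real) \<Rightarrow> ('v config \<Rightarrow> real) \<Rightarrow> 'v config \<Rightarrow> real" where
  "spin_pregenerator c f \<eta> = (\<Sum>\<^sub>\<infinity>u. c u \<eta> * (f (flip u \<eta>) - f \<eta>))"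

definition markov_semigroup ::
    "(real \<Rightarrow> ('v config \<Rightarrow>\<^sub>C real) \<Rightarrow> ('v config \<Rightarrow>\<^sub>C real)) \<Rightarrow> bool" where
  "markov_semigroup S \<longleftrightarrow>
     (\<forall>t\<ge>0. linear (S t)) \<and>
     (\<forall>f. S 0 f = f) \<and>
     (\<forall>f. \<forall>t\<ge>0. ((\<lambda>s. S s f) \<longlongrightarrow> S t f) (at_right t)) \<and>
     (\<forall>f. \<forall>s\<ge>0. \<forall>t\<ge>0. S (s + t) f = S s (S t f)) \<and>
     (\<forall>t\<ge>0. S t (const_bcontfun 1) = const_bcontfun 1) \<and>
     (\<forall>f. \<forall>t\<ge>0. (\<forall>\<eta>. 0 \<le> apply_bcontfun f \<eta>) \<longrightarrow> (\<forall>\<eta>. 0 \<le> apply_bcontfun (S t f) \<eta>))"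

text \<open>\<open>f\<close> lies in the domain of the generator of \<open>S\<close>, and the generator maps \<open>f\<close> to \<open>g\<close>.\<close>

definition generates ::
    "(real \<Rightarrow> ('v config \<Rightarrow>\<^sub>C real) \<Rightarrow> ('v config \<Rightarrow>\<^sub>C real)) \<Rightarrow>
     ('v config \<Rightarrow>\<^sub>C real) \<Rightarrow> ('v config \<Rightarrow>\<^sub>C real) \<Rightarrow> bool" where
  "generates S f g \<longleftrightarrow> ((\<lambda>t. (S t f - f) /\<^sub>R t) \<longlongrightarrow> g) (at_right 0)"

text \<open>
  For uniformly bounded, nonnegative rates of uniformly bounded range, as below, the closure of the
  pregenerator on cylinder functions is a Markov generator (Liggett, Interacting Particle
  Systems, Theorem I.3.9). A Markov generator has no proper extension that is a Markov generator,
  so there is exactly one semigroup with the following property.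
\<close>

definition spin_semigroup ::
    "('v \<Rightarrow> 'v config \<Rightarrow> real) \<Rightarrow>
     (real \<Rightarrow> ('v config \<Rightarrow>\<^sub>C real) \<Rightarrow> ('v config \<Rightarrow>\<^sub>C real)) \<Rightarrow> bool" where
  "spin_semigroup c S \<longleftrightarrow> markov_semigroup S \<and>
     (\<forall>f. cylinder (apply_bcontfun f) \<longrightarrow>
        (\<exists>g. apply_bcontfun g = spin_pregenerator c (apply_bcontfun f) \<and> generates S f g))"

definition past :: "'w measure \<Rightarrow> (real \<Rightarrow> 'w \<Rightarrow> 'v config) \<Rightarrow> real \<Rightarrow> 'w measure" where
  "past M X s = sigma (space M) (\<Union>r\<in>{0..s}. {X r -` B \<inter> space M | B. B \<in> sets borel})"

definition cadlag :: "(real \<Rightarrow> 'v config) \<Rightarrow> bool" where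
  "cadlag x \<longleftrightarrow> (\<forall>t\<ge>0. (x \<longlongrightarrow> x t) (at_right t)) \<and> (\<forall>t>0. \<exists>l. (x \<longlongrightarrow> l) (at_left t))"

text \<open>
  \<open>X t \<omega> u\<close> is the value of site \<open>u\<close> at time \<open>t\<close>; only times \<open>t \<ge> 0\<close> matter.
\<close>

definition spin_system ::
    "('v::countable \<Rightarrow> 'v config \<Rightarrow> real) \<Rightarrow> 'w measure \<Rightarrow> (real \<Rightarrow> 'w \<Rightarrow> 'v config) \<Rightarrow> bool" where
  "spin_system c M X \<longleftrightarrow>
     prob_space M \<and>
     (\<forall>t\<ge>0. X t \<in> borel_measurable M) \<and>
     (\<forall>\<omega>\<in>space M. cadlag (\<lambda>t. X t \<omega>)) \<and>
     (\<exists>S. spin_semigroup c S \<and>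
        (\<forall>f. \<forall>s\<ge>0. \<forall>t\<ge>0. AE \<omega> in M.
           real_cond_exp M (past M X s) (\<lambda>\<omega>'. apply_bcontfun f (X (s + t) \<omega>')) \<omega>
             = apply_bcontfun (S t f) (X s \<omega>)))"


text \<open>
  For kernels of finite range, such as the two below, all sums in the rates have only finitely
  many nonzero terms.
\<close>

definition cVMBC_rate ::
    "('v \<Rightarrow> 'v \<Rightarrow> real) \<Rightarrow> ('v \<Rightarrow> 'v \<times> 'v \<Rightarrow> real) \<Rightarrow> real \<Rightarrow> real \<Rightarrow> 'v \<Rightarrow> 'v config \<Rightarrow> real" where
  "cVMBC_rate a b \<alpha> \<gamma> u x =
     (if \<not> x u then
        (\<Sum>\<^sub>\<infinity>v. a v u * of_bool (x v))
          + \<gamma> * (\<Sum>\<^sub>\<infinity>v. of_bool (x v) * (\<Sum>\<^sub>\<infinity>w. of_bool (x w) * b w (v, u)))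
      else
        (1 + \<alpha>) * (\<Sum>\<^sub>\<infinity>v. a v u * (1 - of_bool (x v)))
          + \<gamma> * (\<Sum>\<^sub>\<infinity>v. (1 - of_bool (x v)) * (\<Sum>\<^sub>\<infinity>w. of_bool (x w) * b w (v, u))))"

definition nn_kernel :: "int \<Rightarrow> int \<Rightarrow> real" where
  "nn_kernel u v = (if \<bar>u - v\<bar> = 1 then 1 / 2 else 0)"

definition coop_kernel :: "int \<Rightarrow> int \<times> int \<Rightarrow> real" where
  "coop_kernel u = (\<lambda>(v, w).
     if \<bar>u - v\<bar> = 1 \<and> \<bar>w - v\<bar> = 1 then 1 / 2 * of_bool (u \<noteq> w) else 0)"

definition cVMBC_Z ::
    "real \<Rightarrow> real \<Rightarrow> 'w measure \<Rightarrow> (real \<Rightarrow> 'w \<Rightarrow> int config) \<Rightarrow> bool" where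
  "cVMBC_Z \<alpha> \<gamma> M X \<longleftrightarrow> spin_system (cVMBC_rate nn_kernel coop_kernel \<alpha> \<gamma>) M X"

definition starts_with_finitely_many ::
    "bool \<Rightarrow> 'w measure \<Rightarrow> (real \<Rightarrow> 'w \<Rightarrow> 'v config) \<Rightarrow> bool" where
  "starts_with_finitely_many i M X \<longleftrightarrow>
     (\<exists>A. finite A \<and> (AE \<omega> in M. X 0 \<omega> = (\<lambda>u. if u \<in> A then i else \<not> i)))"

definition dies_out :: "bool \<Rightarrow> 'w measure \<Rightarrow> (real \<Rightarrow> 'w \<Rightarrow> 'v config) \<Rightarrow> bool" where
  "dies_out i M X \<longleftrightarrow>
     (\<forall>u. measure M {\<omega> \<in> space M. ((\<lambda>t. X t \<omega> u) \<longlongrightarrow> (\<not> i)) at_top} = 1)"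

definition clusters :: "'w measure \<Rightarrow> (real \<Rightarrow> 'w \<Rightarrow> 'v config) \<Rightarrow> bool" where
  "clusters M X \<longleftrightarrow>
     (\<forall>u v. ((\<lambda>t. measure M {\<omega> \<in> space M. X t \<omega> u = X t \<omega> v}) \<longlongrightarrow> 1) at_top)"

abbreviation (input) cooperator :: bool where "cooperator \<equiv> True"
abbreviation (input) defector :: bool where "defector \<equiv> False"

end

theory Submission
  imports Defs
begin

text \<open>
  Write \<open>b\<close> for the background value, that of the infinitely many sites. A site flips only if a
  neighbor has the other value, so everything happens at the interfaces, the pairs of neighbors
  with different values, and the generator of the process, applied to a function of the finitely
  perturbed configurations, is a sum over interfaces (\<open>gen_eq_interface_sum\<close>).

  Extinction. Suppose that the parameters favor the background: \<open>\<gamma> \<le> \<alpha>\<close> for finitely many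
  cooperators, \<open>\<alpha> \<le> \<gamma>\<close> for finitely many defectors. The energy is the number of perturbed sites
  plus \<open>\<gamma> / 2\<close> for each interface. It is a supermartingale, as a check of the four sites around one
  interface shows (\<open>energy_drift_at_interface\<close>). So it stays below a level \<open>K\<close> with probability
  close to 1. Since it also fluctuates at a rate bounded below until the perturbation has
  disappeared, the bounded concave function \<open>e / (1 + e)\<close> of the energy has a drift that is at most
  a negative constant as long as the energy is in \<open>(0, K]\<close>; this cannot go on for long
  (\<open>window_clears\<close>). The constant configuration is absorbing, so its probability
  tends to 1 and almost every path ends in it (\<open>prob_limit_background\<close>).

  Clustering. If the parameters favor the background, this follows from extinction. Otherwise
  \<open>\<alpha> \<noteq> \<gamma>\<close>, so that an interface far from the others is a random walk with drift. The sum over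
  all interfaces of the Green function of this walk at a point \<open>x0\<close>, plus a constant that pays for
  annihilations, decreases on average at least at a fixed multiple of the probability of an
  interface at \<open>x0\<close> (\<open>gen_exit_weight\<close>). So this probability is integrable in time; it is also Lipschitz, and
  hence tends to 0 (\<open>expect_interface_tendsto_0\<close>).

  The semigroup is known only on continuous functions, while the energy is neither continuous nor
  bounded. The functions are therefore cut off to a window \<open>[-L, L]\<close>, outside of which the
  background is restored. The error comes only from perturbed sites at the rim of the window, and a
  perturbation needs \<open>n\<close> successive jumps to reach a site at distance \<open>n\<close>, which has probability at
  most \<open>(B t)\<^sup>n / n!\<close>, where \<open>B\<close> bounds the rates (\<open>expect_differs_le\<close>, \<open>expect_patch_le\<close>).
\<close>

section \<open>Markov semigroups acting on cylinder functions\<close>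

lemma cylinderI:
  "finite D \<Longrightarrow> (\<And>\<eta> \<zeta>. (\<And>u. u \<in> D \<Longrightarrow> \<eta> u = \<zeta> u) \<Longrightarrow> f \<eta> = f \<zeta>) \<Longrightarrow> cylinder f"
  unfolding cylinder_def by blast

text \<open>
  A function of finitely many coordinates takes finitely many values, each of them on an open set.
\<close>

lemma cylinder_bcontfun:
  fixes f :: "'v config \<Rightarrow> real"
  assumes "cylinder f"
  shows "f \<in> bcontfun"
proof -
  from assms obtain D where D: "finite D"
    "\<And>\<eta> \<zeta>. (\<forall>u\<in>D. \<eta> u = \<zeta> u) \<Longrightarrow> f \<eta> = f \<zeta>"
    unfolding cylinder_def by blast
  have "continuous_on UNIV f"
    unfolding continuous_on_def
  proof (intro ballI)
    fix \<eta> :: "'v config"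
    have "\<forall>\<^sub>F \<zeta> in at \<eta>. \<zeta> u = \<eta> u" for u
    proof -
      have "open ((\<lambda>\<zeta> :: 'v config. \<zeta> u) -` {\<eta> u})"
        by (rule open_vimage[OF Topological_Spaces.open_discrete continuous_on_product_coordinates])
      then show ?thesis
        by (auto simp: eventually_at_topological)
    qed
    then have "\<forall>\<^sub>F \<zeta> in at \<eta>. \<forall>u\<in>D. \<zeta> u = \<eta> u"
      using D(1) by (simp add: eventually_ball_finite)
    then have "\<forall>\<^sub>F \<zeta> in at \<eta>. f \<zeta> = f \<eta>"
      by eventually_elim (use D(2) in blast)
    then show "(f \<longlongrightarrow> f \<eta>) (at \<eta> within UNIV)"
      by (simp add: tendsto_eventually)
  qed
  moreover have "range f \<subseteq> f ` ((\<lambda>A u. u \<in> A) ` Pow D)"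
  proof
    fix y assume "y \<in> range f"
    then obtain \<eta> where "y = f \<eta>" by blast
    also have "f \<eta> = f (\<lambda>u. u \<in> {u\<in>D. \<eta> u})"
      by (rule D(2)) auto
    finally show "y \<in> f ` ((\<lambda>A u. u \<in> A) ` Pow D)"
      by blast
  qed
  then have "bounded (range f)"
    using D(1) by (meson finite_Pow_iff finite_imageI finite_imp_bounded finite_subset)
  ultimately show ?thesis
    by (simp add: bcontfun_def)
qed

locale spin_flow =
  fixes c :: "'v \<Rightarrow> 'v config \<Rightarrow> real"
    and S :: "real \<Rightarrow> ('v config \<Rightarrow>\<^sub>C real) \<Rightarrow> ('v config \<Rightarrow>\<^sub>C real)"
  assumes spin: "spin_semigroup c S"
begin

text \<open>
  Written for functions rather than elements of the Banach space, so that explicit cylinder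
  functions can be inserted; it is meaningful for \<open>f \<in> bcontfun\<close>.
\<close>

definition expect :: "real \<Rightarrow> 'v config \<Rightarrow> ('v config \<Rightarrow> real) \<Rightarrow> real" where
  "expect t \<eta> f = apply_bcontfun (S t (Bcontfun f)) \<eta>"

abbreviation gen :: "('v config \<Rightarrow> real) \<Rightarrow> 'v config \<Rightarrow> real" where
  "gen \<equiv> spin_pregenerator c"

lemma semigroup:
  "\<And>t. 0 \<le> t \<Longrightarrow> linear (S t)"
  "\<And>f. S 0 f = f"
  "\<And>f t. 0 \<le> t \<Longrightarrow> ((\<lambda>s. S s f) \<longlongrightarrow> S t f) (at_right t)"
  "\<And>f s t. 0 \<le> s \<Longrightarrow> 0 \<le> t \<Longrightarrow> S (s + t) f = S s (S t f)"
  "\<And>t. 0 \<le> t \<Longrightarrow> S t (const_bcontfun 1) = const_bcontfun 1"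
  "\<And>f t \<eta>. 0 \<le> t \<Longrightarrow> (\<And>\<eta>. 0 \<le> apply_bcontfun f \<eta>) \<Longrightarrow> 0 \<le> apply_bcontfun (S t f) \<eta>"
  using spin unfolding spin_semigroup_def markov_semigroup_def by blast+

lemma expect_bcontfun: "(\<lambda>\<eta>. expect t \<eta> f) \<in> bcontfun"
  unfolding expect_def by (rule apply_bcontfun)

lemma expect_apply: "expect t \<eta> (apply_bcontfun f) = apply_bcontfun (S t f) \<eta>"
  by (simp add: expect_def apply_bcontfun_inverse)

lemma expect_mono:
  assumes "0 \<le> t" "f \<in> bcontfun" "g \<in> bcontfun" "\<And>\<zeta>. f \<zeta> \<le> g \<zeta>"
  shows "expect t \<eta> f \<le> expect t \<eta> g"
proof -
  have "0 \<le> apply_bcontfun (S t (Bcontfun g - Bcontfun f)) \<eta>"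
    using assms by (intro semigroup(6)) (auto simp: Bcontfun_inverse)
  then show ?thesis
    by (simp add: linear_diff[OF semigroup(1)[OF assms(1)]] expect_def)
qed

lemma expect_add:
  assumes "0 \<le> t" "f \<in> bcontfun" "g \<in> bcontfun"
  shows "expect t \<eta> (\<lambda>\<zeta>. f \<zeta> + g \<zeta>) = expect t \<eta> f + expect t \<eta> g"
proof -
  have "Bcontfun (\<lambda>\<zeta>. f \<zeta> + g \<zeta>) = Bcontfun f + Bcontfun g"
    using assms by (intro bcontfun_eqI) (simp add: Bcontfun_inverse plus_cont)
  then show ?thesis
    by (simp add: linear_add[OF semigroup(1)[OF assms(1)]] expect_def)
qed

lemma expect_cmult:
  assumes "0 \<le> t" "f \<in> bcontfun"
  shows "expect t \<eta> (\<lambda>\<zeta>. a * f \<zeta>) = a * expect t \<eta> f"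
proof -
  have "Bcontfun (\<lambda>\<zeta>. a * f \<zeta>) = a *\<^sub>R Bcontfun f"
    using assms scaleR_cont[of f a] by (intro bcontfun_eqI) (simp add: Bcontfun_inverse)
  then show ?thesis
    by (simp add: linear_scale[OF semigroup(1)[OF assms(1)]] expect_def)
qed

lemma expect_const: "0 \<le> t \<Longrightarrow> expect t \<eta> (\<lambda>_. a) = a"
  using expect_cmult[of t "\<lambda>_. 1" \<eta> a] expect_apply[of t \<eta> "const_bcontfun 1"] semigroup(5)[of t]
  by (simp add: const_bcontfun)

lemma expect_sum:
  assumes "0 \<le> t" "finite I" "\<And>i. i \<in> I \<Longrightarrow> f i \<in> bcontfun"
  shows "(\<lambda>\<zeta>. \<Sum>i\<in>I. f i \<zeta>) \<in> bcontfun \<and>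
    expect t \<eta> (\<lambda>\<zeta>. \<Sum>i\<in>I. f i \<zeta>) = (\<Sum>i\<in>I. expect t \<eta> (f i))"
  using assms(2,3)
proof (induction I)
  case empty
  show ?case by (simp add: const_bcontfun expect_const assms(1))
next
  case (insert i I)
  then show ?case
    by (simp add: expect_add assms(1) plus_cont)
qed

lemma expect_0: "f \<in> bcontfun \<Longrightarrow> expect 0 \<eta> f = f \<eta>"
  by (simp add: expect_def semigroup Bcontfun_inverse)

lemma expect_Chapman_Kolmogorov:
  assumes "0 \<le> s" "0 \<le> t"
  shows "expect (s + t) \<eta> f = expect s \<eta> (\<lambda>\<zeta>. expect t \<zeta> f)"
  using assms by (simp add: expect_def semigroup apply_bcontfun_inverse)

lemma norm_semigroup_le:
  assumes "0 \<le> t"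
  shows "norm (S t f) \<le> norm f"
proof (rule norm_bound)
  fix \<eta>
  have *: "\<bar>apply_bcontfun f \<zeta>\<bar> \<le> norm f" for \<zeta>
    using norm_bounded[of f \<zeta>] by simp
  then have "apply_bcontfun f \<zeta> \<le> norm f" "- norm f \<le> apply_bcontfun f \<zeta>" for \<zeta>
    by (meson abs_le_D1 abs_le_iff minus_le_iff order_trans)+
  then have "expect t \<eta> (apply_bcontfun f) \<le> norm f" "- norm f \<le> expect t \<eta> (apply_bcontfun f)"
    using expect_mono[OF assms apply_bcontfun const_bcontfun, of f "norm f" \<eta>]
      expect_mono[OF assms const_bcontfun apply_bcontfun, of "- norm f" f \<eta>]
    by (simp_all add: expect_const assms)
  then show "norm (apply_bcontfun (S t f) \<eta>) \<le> norm f"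
    by (simp add: expect_apply)
qed

lemma semigroup_tendsto_0: "((\<lambda>h. S h f) \<longlongrightarrow> f) (at_right 0)"
  using semigroup(3)[of 0 f] semigroup(2)[of f] by simp

text \<open>
  Contractivity upgrades strong right continuity to strong continuity, because
  \<open>S (t - h) f - S t f = S (t - h) (f - S h f)\<close>.
\<close>

lemma semigroup_left_continuous:
  assumes "0 < t"
  shows "((\<lambda>h. S (t - h) f) \<longlongrightarrow> S t f) (at_right 0)"
proof (rule LIM_zero_cancel, rule Lim_null_comparison)
  have "\<forall>\<^sub>F h in at_right 0. h < t \<and> 0 < h"
    using assms by (auto simp: eventually_at_right_field intro!: exI[of _ t])
  then show "\<forall>\<^sub>F h in at_right 0. norm (S (t - h) f - S t f) \<le> norm (f - S h f)"
  proof eventually_elim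
    case (elim h)
    have "S t f = S (t - h) (S h f)"
      using elim semigroup(4)[of "t - h" h f] by simp
    then have "S (t - h) f - S t f = S (t - h) (f - S h f)"
      using elim linear_diff[OF semigroup(1), of "t - h" f "S h f"] by simp
    then show ?case using norm_semigroup_le[of "t - h"] elim by simp
  qed
  show "((\<lambda>h. norm (f - S h f)) \<longlongrightarrow> 0) (at_right 0)"
    using tendsto_norm[OF tendsto_diff[OF tendsto_const semigroup_tendsto_0[of f], of f]] by simp
qed

lemma tendsto_expect:
  assumes "((\<lambda>x. S (q x) f) \<longlongrightarrow> g) F"
  shows "((\<lambda>x. expect (q x) \<eta> (apply_bcontfun f)) \<longlongrightarrow> apply_bcontfun g \<eta>) F"
  using tendsto_uniform_limitI[OF tendsto_bcontfun_uniform_limit[OF assms], of \<eta>]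
  by (simp add: expect_apply)

lemma at_left_from_right:
  fixes f :: "real \<Rightarrow> 'b :: topological_space"
  assumes "((\<lambda>h. f (t - h)) \<longlongrightarrow> l) (at_right 0)"
  shows "(f \<longlongrightarrow> l) (at_left t)"
  using assms by (simp add: at_left_minus[of t] filterlim_filtermap at_right_to_0[of "-t"])

lemma expect_continuous:
  assumes "f \<in> bcontfun"
  shows "continuous_on {0..T} (\<lambda>t. expect t \<eta> f)"
proof -
  have f: "f = apply_bcontfun (Bcontfun f)"
    using assms by (simp add: Bcontfun_inverse)
  have r: "((\<lambda>t. expect t \<eta> f) \<longlongrightarrow> expect t \<eta> f) (at_right t)" if "0 \<le> t" for t
    using tendsto_expect[OF semigroup(3)[OF that, of "Bcontfun f"], of \<eta>]
    by (simp add: expect_apply[symmetric] f[symmetric])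
  have l: "((\<lambda>t. expect t \<eta> f) \<longlongrightarrow> expect t \<eta> f) (at_left t)" if "0 < t" for t
    using tendsto_expect[OF semigroup_left_continuous[OF that, of "Bcontfun f"], of \<eta>]
    by (intro at_left_from_right) (simp add: expect_apply[symmetric] f[symmetric])
  have "((\<lambda>t. expect t \<eta> f) \<longlongrightarrow> expect t \<eta> f) (at t within {0..T})" if "t \<in> {0..T}" for t
  proof (cases "t = 0")
    case True
    have "at (0 :: real) within {0..T} \<le> at_right 0"
      unfolding at_within_def by (intro inf_mono) auto
    then show ?thesis
      using r[of 0] True by (auto intro: tendsto_mono)
  next
    case False
    with that have "0 < t" by auto
    then have "((\<lambda>t. expect t \<eta> f) \<longlongrightarrow> expect t \<eta> f) (at t)"
      using l[of t] r[of t] by (simp add: filterlim_split_at)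
    then show ?thesis by (rule tendsto_within_subset) simp
  qed
  then show ?thesis by (simp add: continuous_on_def)
qed

lemma gen_bcontfun: "cylinder f \<Longrightarrow> gen f \<in> bcontfun"
  using spin cylinder_bcontfun[of f] unfolding spin_semigroup_def
  by (metis apply_bcontfun Bcontfun_inverse)

text \<open>
  The definition of the generator is a statement about right derivatives at time 0. The semigroup
  property moves it to every time, and contractivity supplies the left derivative, so Kolmogorov's
  forward equation holds in the ordinary sense and the mean value theorem becomes available.
\<close>

lemma expect_deriv:
  assumes f: "cylinder f" and t: "0 < t"
  shows "((\<lambda>t. expect t \<eta> f) has_real_derivative expect t \<eta> (gen f)) (at t)"
proof -
  define F where "F = Bcontfun f"
  have Ff: "apply_bcontfun F = f"
    using cylinder_bcontfun[OF f] by (simp add: F_def Bcontfun_inverse)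
  obtain G where G: "apply_bcontfun G = gen f" "generates S F G"
    using spin f unfolding spin_semigroup_def by (metis Ff)
  define Q where "Q h = (S h F - F) /\<^sub>R h" for h
  have Q: "(Q \<longlongrightarrow> G) (at_right 0)"
    using G(2) by (simp add: generates_def Q_def[abs_def])
  have small: "\<forall>\<^sub>F h in at_right 0. 0 < h \<and> h < t"
    using t by (auto simp: eventually_at_right_field intro!: exI[of _ t])
  have shift: "expect (r + h) \<eta> f - expect r \<eta> f = h * apply_bcontfun (S r (Q h)) \<eta>"
    if "0 \<le> r" "0 < h" for r h
  proof -
    have "S r (S h F) - S r F = h *\<^sub>R S r (Q h)"
      using that by (simp add: Q_def linear_diff[OF semigroup(1)] linear_scale[OF semigroup(1)])
    moreover have "expect (r + h) \<eta> f - expect r \<eta> f = apply_bcontfun (S r (S h F) - S r F) \<eta>"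
      using that by (simp add: expect_def semigroup flip: F_def)
    ultimately show ?thesis by simp
  qed
  have lim: "((\<lambda>h. apply_bcontfun (S (r h) (Q h)) \<eta>) \<longlongrightarrow> expect t \<eta> (gen f)) (at_right 0)"
    if r: "((\<lambda>h. S (r h) G) \<longlongrightarrow> S t G) (at_right 0)" "\<forall>\<^sub>F h in at_right 0. 0 \<le> r h" for r
  proof -
    have "((\<lambda>h. S (r h) (Q h - G)) \<longlongrightarrow> 0) (at_right 0)"
    proof (rule Lim_null_comparison)
      show "\<forall>\<^sub>F h in at_right 0. norm (S (r h) (Q h - G)) \<le> norm (Q h - G)"
        using r(2) by eventually_elim (rule norm_semigroup_le)
      show "((\<lambda>h. norm (Q h - G)) \<longlongrightarrow> 0) (at_right 0)"
        using tendsto_norm[OF LIM_zero[OF Q]] by simp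
    qed
    from tendsto_add[OF this r(1)]
    have "((\<lambda>h. S (r h) (Q h - G) + S (r h) G) \<longlongrightarrow> S t G) (at_right 0)" by simp
    moreover have "\<forall>\<^sub>F h in at_right 0. S (r h) (Q h - G) + S (r h) G = S (r h) (Q h)"
      using r(2) by eventually_elim (simp add: linear_diff[OF semigroup(1)])
    ultimately have "((\<lambda>h. S (r h) (Q h)) \<longlongrightarrow> S t G) (at_right 0)"
      by (rule Lim_transform_eventually)
    then have "((\<lambda>h. apply_bcontfun (S (r h) (Q h)) \<eta>) \<longlongrightarrow> apply_bcontfun (S t G) \<eta>) (at_right 0)"
      by (intro tendsto_uniform_limitI[OF tendsto_bcontfun_uniform_limit]) auto
    then show ?thesis
      by (simp add: G(1)[symmetric] expect_apply)
  qed
  let ?D = "\<lambda>h. (expect (t + h) \<eta> f - expect t \<eta> f) / h"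
  have "(?D \<longlongrightarrow> expect t \<eta> (gen f)) (at_right 0)"
  proof (rule Lim_transform_eventually)
    show "((\<lambda>h. apply_bcontfun (S t (Q h)) \<eta>) \<longlongrightarrow> expect t \<eta> (gen f)) (at_right 0)"
      using t by (intro lim) auto
    show "\<forall>\<^sub>F h in at_right 0. apply_bcontfun (S t (Q h)) \<eta> = ?D h"
      using small by eventually_elim (use t shift in simp)
  qed
  moreover have "((\<lambda>h. ?D (- h)) \<longlongrightarrow> expect t \<eta> (gen f)) (at_right 0)"
  proof (rule Lim_transform_eventually)
    show "((\<lambda>h. apply_bcontfun (S (t - h) (Q h)) \<eta>) \<longlongrightarrow> expect t \<eta> (gen f)) (at_right 0)"
      using small by (intro lim semigroup_left_continuous[OF t]) (auto elim: eventually_mono)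
    show "\<forall>\<^sub>F h in at_right 0. apply_bcontfun (S (t - h) (Q h)) \<eta> = ?D (- h)"
      using small
    proof eventually_elim
      case (elim h)
      then show ?case using shift[of "t - h" h] by (simp add: field_simps)
    qed
  qed
  then have "(?D \<longlongrightarrow> expect t \<eta> (gen f)) (at_left 0)"
    by (intro at_left_from_right) simp
  ultimately show ?thesis
    by (simp add: DERIV_def filterlim_split_at)
qed

text \<open>The estimates of the process below are applications of this integrated form.\<close>

lemma expect_le_if_gen_le:
  assumes f: "cylinder f" and T: "0 \<le> T"
    and H: "continuous_on {0..T} H" "\<And>s. 0 < s \<Longrightarrow> s < T \<Longrightarrow> (H has_real_derivative h s) (at s)"
    and le: "\<And>s. 0 < s \<Longrightarrow> s < T \<Longrightarrow> expect s \<eta> (gen f) \<le> h s"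
  shows "expect T \<eta> f \<le> f \<eta> + (H T - H 0)"
proof -
  have "expect T \<eta> f - H T \<le> expect 0 \<eta> f - H 0"
  proof (rule DERIV_nonpos_imp_decreasing_open[OF T])
    fix s assume s: "0 < s" "s < T"
    show "\<exists>y. ((\<lambda>s. expect s \<eta> f - H s) has_real_derivative y) (at s) \<and> y \<le> 0"
      using DERIV_diff[OF expect_deriv[OF f s(1)] H(2)[OF s]] le[OF s]
      by (intro exI conjI) auto
  qed (intro continuous_intros H(1) expect_continuous cylinder_bcontfun[OF f])
  then show ?thesis
    using f by (simp add: expect_0 cylinder_bcontfun)
qed

lemma expect_Lipschitz:
  assumes f: "cylinder f"
  obtains K where "0 < K" "\<And>s t. 0 \<le> s \<Longrightarrow> s \<le> t \<Longrightarrow> \<bar>expect t \<eta> f - expect s \<eta> f\<bar> \<le> K * (t - s)"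
proof -
  define K where "K = norm (Bcontfun (gen f)) + 1"
  have b: "\<bar>expect s \<eta> (gen f)\<bar> \<le> K" if "0 \<le> s" for s
    using norm_bounded[of "S s (Bcontfun (gen f))" \<eta>] norm_semigroup_le[OF that, of "Bcontfun (gen f)"]
    by (simp add: expect_def K_def)
  have "\<bar>expect t \<eta> f - expect s \<eta> f\<bar> \<le> K * (t - s)" if "0 \<le> s" "s \<le> t" for s t
  proof -
    have c: "continuous_on {s..t} (\<lambda>s. expect s \<eta> f)"
      by (rule continuous_on_subset[OF expect_continuous[OF cylinder_bcontfun[OF f], of t]])
        (use that in auto)
    have "expect t \<eta> f - K * t \<le> expect s \<eta> f - K * s"
    proof (rule DERIV_nonpos_imp_decreasing_open[OF that(2)])
      fix r assume "s < r" "r < t"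
      then show "\<exists>y. ((\<lambda>s. expect s \<eta> f - K * s) has_real_derivative y) (at r) \<and> y \<le> 0"
        using that b[of r]
        by (intro exI[of _ "expect r \<eta> (gen f) - K"]) (auto intro!: derivative_eq_intros expect_deriv[OF f])
    qed (intro continuous_intros c)
    moreover have "expect s \<eta> f + K * s \<le> expect t \<eta> f + K * t"
    proof (rule DERIV_nonneg_imp_increasing_open[OF that(2)])
      fix r assume "s < r" "r < t"
      then show "\<exists>y. ((\<lambda>s. expect s \<eta> f + K * s) has_real_derivative y) (at r) \<and> 0 \<le> y"
        using that b[of r]
        by (intro exI[of _ "expect r \<eta> (gen f) + K"]) (auto intro!: derivative_eq_intros expect_deriv[OF f])
    qed (intro continuous_intros c)
    ultimately show ?thesis by (auto simp: algebra_simps)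
  qed
  moreover have "0 < K" by (simp add: K_def add_nonneg_pos)
  ultimately show thesis using that by blast
qed

end

section \<open>Rates and interfaces of the one-dimensional process\<close>

text \<open>
  The part of the flip rate of \<open>u\<close> that is due to its neighbor \<open>u + e\<close>, where \<open>e = \<plusminus>1\<close>. Whether
  that neighbor is a cooperator or a defector, it is a cooperator behind it, at \<open>u + 2 * e\<close>, that
  adds the cooperation rate.
\<close>

definition push :: "real \<Rightarrow> real \<Rightarrow> int \<Rightarrow> int config \<Rightarrow> int \<Rightarrow> real" where
  "push \<alpha> \<gamma> e X u =
     of_bool (X (u + e) \<noteq> X u) * (1 + \<alpha> * of_bool (X u) + \<gamma> * of_bool (X (u + 2 * e))) / 2"

lemma infsum_eq_sum_on:
  fixes f :: "'v \<Rightarrow> real"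
  assumes "finite D" "\<And>u. u \<notin> D \<Longrightarrow> f u = 0"
  shows "(\<Sum>\<^sub>\<infinity>u. f u) = (\<Sum>u\<in>D. f u)"
proof -
  have "(\<Sum>\<^sub>\<infinity>u. f u) = (\<Sum>\<^sub>\<infinity>u\<in>D. f u)"
    using assms by (intro infsum_cong_neutral) auto
  then show ?thesis using assms(1) by simp
qed

lemma sum_neighbors:
  fixes f :: "int \<Rightarrow> real"
  assumes "\<And>v. \<bar>v - u\<bar> \<noteq> 1 \<Longrightarrow> f v = 0"
  shows "(\<Sum>\<^sub>\<infinity>v. f v) = f (u + 1) + f (u + -1)"
proof -
  have "(\<Sum>\<^sub>\<infinity>v. f v) = (\<Sum>v\<in>{u + 1, u + -1}. f v)"
    using assms by (intro infsum_eq_sum_on) force+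
  then show ?thesis by simp
qed

lemma sum_coop_kernel:
  assumes "\<bar>v - u\<bar> = 1"
  shows "(\<Sum>\<^sub>\<infinity>w. of_bool (X w) * coop_kernel w (v, u)) = of_bool (X (2 * v - u)) / 2"
proof -
  have "of_bool (X w) * coop_kernel w (v, u) = 0" if "w \<noteq> 2 * v - u" for w
    using that assms by (auto simp: coop_kernel_def)
  then have "(\<Sum>\<^sub>\<infinity>w. of_bool (X w) * coop_kernel w (v, u))
      = (\<Sum>w\<in>{2 * v - u}. of_bool (X w) * coop_kernel w (v, u))"
    by (intro infsum_eq_sum_on) auto
  also have "\<dots> = of_bool (X (2 * v - u)) * coop_kernel (2 * v - u) (v, u)"
    by (simp only: sum.insert finite.emptyI empty_iff not_False_eq_True sum.empty add_0_right)
  finally show ?thesis using assms by (auto simp: coop_kernel_def)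
qed

lemma cVMBC_rate_eq_push:
  "cVMBC_rate nn_kernel coop_kernel \<alpha> \<gamma> u X = push \<alpha> \<gamma> 1 X u + push \<alpha> \<gamma> (-1) X u"
proof -
  have coop: "(\<Sum>\<^sub>\<infinity>v. g (X v) * (\<Sum>\<^sub>\<infinity>w. of_bool (X w) * coop_kernel w (v, u)))
      = g (X (u + 1)) * (of_bool (X (u + 2)) / 2) + g (X (u + -1)) * (of_bool (X (u - 2)) / 2)"
    for g :: "bool \<Rightarrow> real"
  proof -
    have "(\<Sum>\<^sub>\<infinity>w. of_bool (X w) * coop_kernel w (v, u)) = 0" if "\<bar>v - u\<bar> \<noteq> 1" for v
      using that by (simp add: coop_kernel_def abs_minus_commute)
    then show ?thesis
      by (subst sum_neighbors[of u]) (simp_all add: sum_coop_kernel algebra_simps)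
  qed
  have nn: "(\<Sum>\<^sub>\<infinity>v. nn_kernel v u * g (X v)) = (g (X (u + 1)) + g (X (u + -1))) / 2"
    for g :: "bool \<Rightarrow> real"
    by (subst sum_neighbors[of u]) (auto simp: nn_kernel_def)
  show ?thesis
    unfolding cVMBC_rate_def nn[of of_bool] nn[of "\<lambda>i. 1 - of_bool i"]
      coop[of of_bool] coop[of "\<lambda>i. 1 - of_bool i"]
    by (cases "X u"; cases "X (u + 1)"; cases "X (u + -1)") (simp_all add: push_def field_simps)
qed

lemma spin_pregenerator_eq_sum:
  assumes "finite D" "\<And>u. u \<notin> D \<Longrightarrow> c u X = 0 \<or> f (flip u X) = f X"
  shows "spin_pregenerator c f X = (\<Sum>u\<in>D. c u X * (f (flip u X) - f X))"
  unfolding spin_pregenerator_def using assms by (intro infsum_eq_sum_on) auto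

locale cVMBC_flow =
  fixes \<alpha> \<gamma> :: real
    and S :: "real \<Rightarrow> (int config \<Rightarrow>\<^sub>C real) \<Rightarrow> (int config \<Rightarrow>\<^sub>C real)"
  assumes \<alpha>: "0 \<le> \<alpha>" and \<gamma>: "0 \<le> \<gamma>"
    and spin: "spin_semigroup (cVMBC_rate nn_kernel coop_kernel \<alpha> \<gamma>) S"

sublocale cVMBC_flow \<subseteq> spin_flow "cVMBC_rate nn_kernel coop_kernel \<alpha> \<gamma>" S
  by unfold_locales (rule spin)

context cVMBC_flow
begin

abbreviation rate :: "int \<Rightarrow> int config \<Rightarrow> real" where
  "rate \<equiv> cVMBC_rate nn_kernel coop_kernel \<alpha> \<gamma>"

abbreviation pushes :: "int \<Rightarrow> int config \<Rightarrow> int \<Rightarrow> real" where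
  "pushes \<equiv> push \<alpha> \<gamma>"

definition max_rate :: real where
  "max_rate = 1 + \<alpha> + \<gamma>"

lemma max_rate_pos: "0 < max_rate"
  using \<alpha> \<gamma> by (simp add: max_rate_def)

lemma push_nonneg: "0 \<le> pushes e X u"
  using \<alpha> \<gamma> by (simp add: push_def)

lemma push_le: "pushes e X u \<le> max_rate / 2 * of_bool (X (u + e) \<noteq> X u)"
  using \<alpha> \<gamma> by (auto simp: push_def max_rate_def)

lemma rate_nonneg: "0 \<le> rate u X"
  by (simp add: cVMBC_rate_eq_push push_nonneg)

lemma rate_le: "rate u X \<le> max_rate"
proof -
  have "pushes e X u \<le> max_rate / 2" for e
    using push_le[of e X u] max_rate_pos by (cases "X (u + e) = X u") auto
  from this[of 1] this[of "-1"] show ?thesis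
    by (simp add: cVMBC_rate_eq_push)
qed

lemma rate_cong:
  assumes "\<And>y. \<bar>y - u\<bar> \<le> 2 \<Longrightarrow> X y = Y y"
  shows "rate u X = rate u Y"
  using assms[of u] assms[of "u + 1"] assms[of "u - 1"] assms[of "u + 2"] assms[of "u - 2"]
  by (simp add: cVMBC_rate_eq_push push_def)

lemma rate_eq_0: "X (u + 1) = X u \<Longrightarrow> X (u - 1) = X u \<Longrightarrow> rate u X = 0"
  by (simp add: cVMBC_rate_eq_push push_def)

section \<open>Finite speed of propagation\<close>

abbreviation differs :: "bool \<Rightarrow> int \<Rightarrow> int config \<Rightarrow> real" where
  "differs b x X \<equiv> of_bool (X x \<noteq> b)"

lemma cylinder_differs: "cylinder (differs b x)"
  by (rule cylinderI[of "{x}"]) auto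

text \<open>
  A site can leave the background value \<open>b\<close> only next to a site that has left it. So each unit of
  distance costs one more integration in time of the rate, and \<open>n\<close> nested integrals give
  \<open>t\<^sup>n / n!\<close>.
\<close>

lemma expect_differs_le:
  assumes "0 \<le> t" "\<And>y. \<bar>y - x\<bar> < int n \<Longrightarrow> \<eta> y = b"
  shows "expect t \<eta> (differs b x) \<le> (max_rate * t) ^ n / fact n"
  using assms
proof (induction n arbitrary: x t)
  case 0
  have "expect t \<eta> (differs b x) \<le> expect t \<eta> (\<lambda>_. 1)"
    using 0 by (intro expect_mono cylinder_bcontfun cylinder_differs const_bcontfun) auto
  then show ?case using 0 by (simp add: expect_const)
next
  case (Suc n)
  define B where "B = max_rate"
  have Bpos: "0 < B" by (simp add: B_def max_rate_pos)
  let ?g = "\<lambda>X. B / 2 * (differs b (x + 1) X + differs b (x + -1) X)"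
  let ?H = "\<lambda>s. (B * s) ^ Suc n / fact (Suc n)"
  have bc: "differs b y \<in> bcontfun" for y
    by (intro cylinder_bcontfun cylinder_differs)
  have gen: "gen (differs b x) X \<le> ?g X" for X
  proof -
    have "gen (differs b x) X
        = (\<Sum>u\<in>{x}. rate u X * (differs b x (flip u X) - differs b x X))"
      by (rule spin_pregenerator_eq_sum) (auto simp: flip_def)
    also have "\<dots> \<le> ?g X"
    proof (cases "X x = b")
      case True
      then show ?thesis
        using push_le[of 1 X x] push_le[of "-1" X x]
        by (simp add: flip_def cVMBC_rate_eq_push B_def distrib_left)
    next
      case False
      have "0 \<le> ?g X" using Bpos by simp
      with False rate_nonneg[of x X] show ?thesis by (simp add: flip_def)
    qed
    finally show ?thesis .
  qed
  have "expect t \<eta> (differs b x) \<le> differs b x \<eta> + (?H t - ?H 0)"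
  proof (rule expect_le_if_gen_le[OF cylinder_differs Suc.prems(1)])
    show "continuous_on {0..t} ?H" by (intro continuous_intros) auto
    fix s assume s: "0 < s" "s < t"
    show "(?H has_real_derivative B * ((B * s) ^ n / fact n)) (at s)"
      by (auto intro!: derivative_eq_intros simp: divide_simps) (cases n; simp add: algebra_simps)
    have IH: "expect s \<eta> (differs b (x + e)) \<le> (B * s) ^ n / fact n" if "\<bar>e\<bar> = 1" for e
      unfolding B_def using s that by (intro Suc.IH Suc.prems(2)) auto
    have "expect s \<eta> (gen (differs b x)) \<le> expect s \<eta> ?g"
      using s gen bc by (intro expect_mono gen_bcontfun cylinder_differs
          scaleR_cont[where 'b = real, simplified] plus_cont) auto
    also have "\<dots> = B / 2 * (expect s \<eta> (differs b (x + 1)) + expect s \<eta> (differs b (x + -1)))"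
      using s bc by (subst expect_cmult) (auto intro!: plus_cont simp: expect_add)
    also have "\<dots> \<le> B / 2 * ((B * s) ^ n / fact n + (B * s) ^ n / fact n)"
      using Bpos by (intro mult_left_mono add_mono IH) auto
    finally show "expect s \<eta> (gen (differs b x)) \<le> B * ((B * s) ^ n / fact n)"
      by simp
  qed
  moreover have "differs b x \<eta> = 0"
    using Suc.prems(2)[of x] by simp
  ultimately show ?case by (simp add: B_def)
qed

section \<open>Dynkin's formula for functions of finitely perturbed configurations\<close>

definition patch :: "bool \<Rightarrow> nat \<Rightarrow> int config \<Rightarrow> int config" where
  "patch b L X = (\<lambda>x. if \<bar>x\<bar> \<le> int L then X x else b)"

definition shell :: "nat \<Rightarrow> int set" where
  "shell L = {y. int L \<le> \<bar>y\<bar> \<and> \<bar>y\<bar> \<le> int L + 2}"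

lemma finite_abs_le: "finite {x. \<bar>x\<bar> \<le> (m :: int)}"
  by (rule finite_subset[of _ "{-m..m}"]) auto

lemma finite_perturbation_in_window:
  assumes "finite {x. \<eta> x \<noteq> (b :: bool)}"
  obtains m where "\<And>y :: int. int m < \<bar>y\<bar> \<Longrightarrow> \<eta> y = b"
proof (rule that)
  let ?N = "insert 0 (abs ` {x. \<eta> x \<noteq> b})"
  fix y assume y: "int (nat (Max ?N)) < \<bar>y\<bar>"
  show "\<eta> y = b"
  proof (rule ccontr)
    assume "\<eta> y \<noteq> b"
    then have "\<bar>y\<bar> \<le> Max ?N" using assms by (intro Max_ge) auto
    with y show False by linarith
  qed
qed

lemma finite_patch: "finite {x. patch b L X x \<noteq> b}"
  by (rule finite_subset[OF _ finite_abs_le[of "int L"]]) (auto simp: patch_def)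

lemma cylinder_patch: "cylinder (\<lambda>X. F (patch b L X))"
proof (rule cylinderI[OF finite_abs_le[of "int L"]])
  fix \<eta> \<zeta> :: "int config" assume "\<And>u. u \<in> {x. \<bar>x\<bar> \<le> int L} \<Longrightarrow> \<eta> u = \<zeta> u"
  then have "patch b L \<eta> = patch b L \<zeta>" by (auto simp: patch_def)
  then show "F (patch b L \<eta>) = F (patch b L \<zeta>)" by simp
qed

lemma finite_shell: "finite (shell L)" and card_shell: "card (shell L) \<le> 6"
proof -
  let ?l = "[int L, int L + 1, int L + 2, - int L, - int L - 1, - int L - 2]"
  have *: "shell L \<subseteq> set ?l" by (auto simp: shell_def)
  then show "finite (shell L)" by (rule finite_subset) simp
  have "card (shell L) \<le> card (set ?l)" using * by (intro card_mono) auto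
  also have "\<dots> \<le> 6" using card_length[of ?l] by simp
  finally show "card (shell L) \<le> 6" .
qed

text \<open>
  Cutting \<open>F\<close> off to a window commutes with the generator except for flips at the rim of the
  window. There are at most six rim sites, whatever the size of the window, and they matter only if
  the configuration differs from the background in the shell around them.
\<close>

lemma gen_patch_le:
  assumes Lip: "\<And>Y u. finite {x. Y x \<noteq> b} \<Longrightarrow> \<bar>F (flip u Y) - F Y\<bar> \<le> K"
  shows "gen (\<lambda>X. F (patch b L X)) X
    \<le> gen F (patch b L X) + 6 * K * max_rate * (\<Sum>y\<in>shell L. differs b y X)"
proof -
  define Y where "Y = patch b L X"
  define \<delta> where "\<delta> u = F (flip u Y) - F Y" for u
  define W where "W = {- int L - 1..int L + 1}"
  define U where "U = {u. int L - 1 \<le> \<bar>u\<bar> \<and> \<bar>u\<bar> \<le> int L + 1}"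
  define D where "D = (\<Sum>y\<in>shell L. differs b y X)"
  define r where "r u = (if \<bar>u\<bar> \<le> int L then rate u X else 0)" for u
  have K: "\<bar>\<delta> u\<bar> \<le> K" for u
    unfolding \<delta>_def Y_def by (intro Lip finite_patch)
  then have "0 \<le> K" by (meson abs_ge_zero order_trans)
  have D0: "0 \<le> D" by (simp add: D_def sum_nonneg)
  have pf: "patch b L (flip u X) = (if \<bar>u\<bar> \<le> int L then flip u Y else Y)" for u
    by (rule ext) (auto simp: patch_def Y_def flip_def)
  have g1: "gen (\<lambda>X. F (patch b L X)) X = (\<Sum>u\<in>W. r u * \<delta> u)"
    unfolding W_def
    by (subst spin_pregenerator_eq_sum[of "{- int L - 1..int L + 1}"])
      (auto simp: pf r_def \<delta>_def Y_def intro!: sum.cong)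
  have g2: "gen F Y = (\<Sum>u\<in>W. rate u Y * \<delta> u)"
    unfolding W_def \<delta>_def
    by (rule spin_pregenerator_eq_sum) (auto simp: Y_def patch_def intro!: rate_eq_0)
  have diff: "(r u - rate u Y) * \<delta> u \<le> max_rate * D * K * of_bool (u \<in> U)" if u: "u \<in> W" for u
  proof (cases "u \<in> U")
    case False
    then have "\<bar>u\<bar> \<le> int L - 2" using u by (auto simp: U_def W_def)
    then have "r u = rate u Y" unfolding r_def
      by (auto simp: Y_def patch_def intro!: rate_cong)
    then show ?thesis using False by simp
  next
    case True
    have "\<bar>r u - rate u Y\<bar> \<le> max_rate * D"
    proof (cases "\<forall>y\<in>shell L. X y = b")
      case True
      then have XY: "X y = Y y" if "\<bar>y\<bar> \<le> int L + 2" for y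
        using that by (auto simp: Y_def patch_def shell_def)
      have "r u = rate u Y"
      proof (cases "\<bar>u\<bar> \<le> int L")
        case True
        then show ?thesis using XY by (auto simp: r_def intro!: rate_cong)
      next
        case False
        then consider "u = int L + 1" | "u = - int L - 1"
          using u unfolding W_def by fastforce
        then have "rate u Y = 0"
        proof cases
          case 1
          have "X (int L) = b" using True by (auto simp: shell_def)
          with 1 show ?thesis by (intro rate_eq_0) (auto simp: Y_def patch_def)
        next
          case 2
          have "X (- int L) = b" using True by (auto simp: shell_def)
          with 2 show ?thesis by (intro rate_eq_0) (auto simp: Y_def patch_def)
        qed
        with False show ?thesis by (simp add: r_def)
      qed
      then show ?thesis using D0 max_rate_pos by simp
    next
      case False
      then obtain y where y: "y \<in> shell L" "X y \<noteq> b" by auto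
      then have "differs b y X \<le> D"
        unfolding D_def by (intro member_le_sum finite_shell) auto
      then have "max_rate * 1 \<le> max_rate * D"
        using y max_rate_pos by (intro mult_left_mono) auto
      moreover have "\<bar>r u - rate u Y\<bar> \<le> max_rate"
        using rate_nonneg[of u X] rate_nonneg[of u Y] rate_le[of u X] rate_le[of u Y]
        by (auto simp: r_def)
      ultimately show ?thesis by simp
    qed
    then have "\<bar>r u - rate u Y\<bar> * \<bar>\<delta> u\<bar> \<le> max_rate * D * K"
      using K[of u] by (intro mult_mono) auto
    then show ?thesis
      using True abs_ge_self[of "(r u - rate u Y) * \<delta> u"] by (simp add: abs_mult)
  qed
  let ?l = "[int L - 1, int L, int L + 1, 1 - int L, - int L, - int L - 1]"
  have "W \<inter> U \<subseteq> set ?l" by (auto simp: U_def)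
  then have "card (W \<inter> U) \<le> card (set ?l)" by (intro card_mono) auto
  also have "\<dots> \<le> 6" using card_length[of ?l] by simp
  finally have U6: "card (W \<inter> U) \<le> 6" .
  have "(\<Sum>u\<in>W. r u * \<delta> u) - (\<Sum>u\<in>W. rate u Y * \<delta> u) = (\<Sum>u\<in>W. (r u - rate u Y) * \<delta> u)"
    by (simp add: sum_subtractf left_diff_distrib)
  also have "\<dots> \<le> (\<Sum>u\<in>W. max_rate * D * K * of_bool (u \<in> U))"
    by (intro sum_mono diff)
  also have "\<dots> = max_rate * D * K * real (card (W \<inter> U))"
    by (simp add: W_def sum.If_cases Collect_conj_eq flip: sum_distrib_left)
  also have "\<dots> \<le> max_rate * D * K * 6"
    using U6 D0 \<open>0 \<le> K\<close> max_rate_pos by (intro mult_left_mono) auto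
  finally show ?thesis
    using g1 g2 by (simp add: Y_def D_def algebra_simps)
qed

text \<open>The factor 36 counts pairs of one of six rim sites and one of six sites of the shell.\<close>

definition leak :: "real \<Rightarrow> nat \<Rightarrow> real" where
  "leak T n = 36 * max_rate * ((max_rate * T) ^ n / fact n)"

lemma power_over_fact_tendsto_0: "(\<lambda>n. (x :: real) ^ n / fact n) \<longlonglongrightarrow> 0"
  using summable_LIMSEQ_zero[OF summable_exp[of x]] by (simp add: field_simps)

lemma leak_tendsto_0: "leak T \<longlonglongrightarrow> 0"
  unfolding leak_def[abs_def] using tendsto_mult_right_zero[OF power_over_fact_tendsto_0] .

text \<open>
  Dynkin's formula for a function \<open>F\<close> that changes by a bounded amount at a flip. The rim of the
  window is at distance \<open>n\<close> from the initial perturbation, so the error vanishes as \<open>n\<close> grows.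
\<close>

lemma expect_patch_le:
  assumes Lip: "\<And>Y u. finite {x. Y x \<noteq> b} \<Longrightarrow> \<bar>F (flip u Y) - F Y\<bar> \<le> K"
    and \<eta>: "\<And>y. int m < \<bar>y\<bar> \<Longrightarrow> \<eta> y = b" and T: "0 \<le> T"
    and H: "continuous_on {0..T} H" "\<And>s. 0 < s \<Longrightarrow> s < T \<Longrightarrow> (H has_real_derivative h s) (at s)"
    and le: "\<And>s. 0 < s \<Longrightarrow> s < T \<Longrightarrow> expect s \<eta> (\<lambda>X. gen F (patch b (m + n) X)) \<le> h s"
  shows "expect T \<eta> (\<lambda>X. F (patch b (m + n) X)) \<le> F \<eta> + (H T - H 0) + T * (K * leak T n)"
proof -
  let ?L = "m + n"
  have K0: "0 \<le> K"
    using abs_ge_zero Lip[of "\<lambda>_. b" 0] by (rule order_trans) simp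
  have "patch b ?L \<eta> = \<eta>"
    using \<eta> by (auto simp: patch_def)
  moreover have "expect T \<eta> (\<lambda>X. F (patch b ?L X)) \<le> F (patch b ?L \<eta>) +
      ((H T + T * (K * leak T n)) - (H 0 + 0 * (K * leak T n)))"
  proof (rule expect_le_if_gen_le[OF cylinder_patch T])
    show "continuous_on {0..T} (\<lambda>s. H s + s * (K * leak T n))"
      by (intro continuous_intros H(1))
    fix s assume s: "0 < s" "s < T"
    show "((\<lambda>s. H s + s * (K * leak T n)) has_real_derivative (h s + K * leak T n)) (at s)"
      by (auto intro!: derivative_eq_intros H(2) s)
    have bc: "differs b y \<in> bcontfun" for y
      by (intro cylinder_bcontfun cylinder_differs)
    have sh: "expect s \<eta> (differs b y) \<le> (max_rate * T) ^ n / fact n" if "y \<in> shell ?L" for y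
    proof -
      have "expect s \<eta> (differs b y) \<le> (max_rate * s) ^ n / fact n"
        using s that by (intro expect_differs_le \<eta>) (auto simp: shell_def)
      also have "\<dots> \<le> (max_rate * T) ^ n / fact n"
        using s max_rate_pos by (intro divide_right_mono power_mono mult_left_mono) auto
      finally show ?thesis .
    qed
    have "(\<Sum>y\<in>shell ?L. expect s \<eta> (differs b y)) \<le> real (card (shell ?L)) * ((max_rate * T) ^ n / fact n)"
      by (intro sum_bounded_above sh)
    also have "\<dots> \<le> 6 * ((max_rate * T) ^ n / fact n)"
      using card_shell[of ?L] T max_rate_pos by (intro mult_right_mono) auto
    finally have "6 * K * max_rate * (\<Sum>y\<in>shell ?L. expect s \<eta> (differs b y))
        \<le> 6 * K * max_rate * (6 * ((max_rate * T) ^ n / fact n))"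
      using K0 max_rate_pos by (intro mult_left_mono) auto
    also have "\<dots> = K * leak T n"
      by (simp add: leak_def)
    finally have rim: "6 * K * max_rate * (\<Sum>y\<in>shell ?L. expect s \<eta> (differs b y)) \<le> K * leak T n" .
    let ?R = "\<lambda>X. \<Sum>y\<in>shell ?L. differs b y X"
    have R: "?R \<in> bcontfun" "expect s \<eta> ?R = (\<Sum>y\<in>shell ?L. expect s \<eta> (differs b y))"
      using expect_sum[of s "shell ?L" "differs b" \<eta>] bc s finite_shell by auto
    have R': "(\<lambda>X. 6 * K * max_rate * ?R X) \<in> bcontfun"
      using scaleR_cont[OF R(1), of "6 * K * max_rate"] by simp
    have G: "(\<lambda>X. gen F (patch b ?L X)) \<in> bcontfun"
      by (intro cylinder_bcontfun cylinder_patch)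
    have "expect s \<eta> (gen (\<lambda>X. F (patch b ?L X)))
        \<le> expect s \<eta> (\<lambda>X. gen F (patch b ?L X) + 6 * K * max_rate * ?R X)"
      using s Lip by (intro expect_mono gen_bcontfun cylinder_patch plus_cont G R' gen_patch_le) auto
    also have "\<dots> = expect s \<eta> (\<lambda>X. gen F (patch b ?L X)) + 6 * K * max_rate * expect s \<eta> ?R"
      by (simp only: expect_add[OF less_imp_le[OF s(1)] G R'] expect_cmult[OF less_imp_le[OF s(1)] R(1)])
    also have "\<dots> \<le> h s + K * leak T n"
      unfolding R(2) by (rule add_mono[OF le[OF s] rim])
    finally show "expect s \<eta> (gen (\<lambda>X. F (patch b ?L X))) \<le> h s + K * leak T n" .
  qed
  ultimately show ?thesis by simp
qed

end

section \<open>Functions of the interfaces\<close>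

definition interfaces :: "int config \<Rightarrow> int set" where
  "interfaces X = {x. X x \<noteq> X (x + 1)}"

definition interface_sum :: "(int \<Rightarrow> bool \<Rightarrow> real) \<Rightarrow> int config \<Rightarrow> real" where
  "interface_sum w X = (\<Sum>x\<in>interfaces X. w x (X x))"

definition perturbation :: "bool \<Rightarrow> int config \<Rightarrow> real" where
  "perturbation b X = real (card {x. X x \<noteq> b})"

lemma finite_interfaces:
  assumes "finite {x. X x \<noteq> b}"
  shows "finite (interfaces X)"
proof (rule finite_subset)
  show "interfaces X \<subseteq> {x. X x \<noteq> b} \<union> (\<lambda>x. x - 1) ` {x. X x \<noteq> b}"
  proof
    fix x assume "x \<in> interfaces X"
    then have "X x \<noteq> b \<or> X (x + 1) \<noteq> b" by (auto simp: interfaces_def)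
    then show "x \<in> {x. X x \<noteq> b} \<union> (\<lambda>x. x - 1) ` {x. X x \<noteq> b}"
      by (auto intro: image_eqI[of _ _ "x + 1"])
  qed
qed (use assms in auto)

lemma interfaces_nonempty:
  assumes "finite {x. X x \<noteq> b}" "X \<noteq> (\<lambda>_. b)"
  shows "interfaces X \<noteq> {}"
proof -
  let ?m = "Max {x. X x \<noteq> b}"
  have ne: "{x. X x \<noteq> b} \<noteq> {}" using assms(2) by auto
  have "X ?m \<noteq> b" using Max_in[OF assms(1) ne] by simp
  moreover have "X (?m + 1) = b"
    using Max_ge[OF assms(1), of "?m + 1"] by force
  ultimately show ?thesis by (auto simp: interfaces_def)
qed

lemma perturbation_flip:
  assumes "finite {x. X x \<noteq> b}"
  shows "perturbation b (flip u X) - perturbation b X = (if X u = b then 1 else -1)"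
proof (cases "X u = b")
  case True
  then have "{x. flip u X x \<noteq> b} = insert u {x. X x \<noteq> b}"
    by (auto simp: flip_def)
  with True assms show ?thesis by (simp add: perturbation_def)
next
  case False
  then have "{x. X x \<noteq> b} = insert u {x. flip u X x \<noteq> b}" "u \<notin> {x. flip u X x \<noteq> b}"
    by (auto simp: flip_def)
  moreover from this assms have "finite {x. flip u X x \<noteq> b}" by (metis finite_insert)
  ultimately have "card {x. X x \<noteq> b} = Suc (card {x. flip u X x \<noteq> b})"
    by (metis card_insert_disjoint)
  with False show ?thesis by (simp add: perturbation_def)
qed

lemma interface_sum_flip:
  assumes "finite (interfaces X)"
  shows "interface_sum w (flip u X) - interface_sum w X =
      of_bool (X (u - 1) = X u) * w (u - 1) (X (u - 1)) + of_bool (X u = X (u + 1)) * w u (\<not> X u)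
    - of_bool (X (u - 1) \<noteq> X u) * w (u - 1) (X (u - 1)) - of_bool (X u \<noteq> X (u + 1)) * w u (X u)"
proof -
  define J where "J = interfaces X \<union> {u - 1, u}"
  define t where "t Y x = of_bool (Y x \<noteq> Y (x + 1)) * w x (Y x)" for Y x
  have J: "finite J" using assms by (simp add: J_def)
  have sum: "interface_sum w Y = (\<Sum>x\<in>J. t Y x)" if "interfaces Y \<subseteq> J" for Y
    unfolding interface_sum_def using that J
    by (intro sum.mono_neutral_cong_left) (auto simp: t_def interfaces_def)
  have "interfaces (flip u X) \<subseteq> J"
    by (auto simp: J_def interfaces_def flip_def split: if_splits)
  moreover have "interfaces X \<subseteq> J" by (auto simp: J_def)
  ultimately have "interface_sum w (flip u X) - interface_sum w X
      = (\<Sum>x\<in>J. t (flip u X) x - t X x)"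
    by (simp add: sum sum_subtractf)
  also have "\<dots> = (\<Sum>x\<in>{u - 1, u}. t (flip u X) x - t X x)"
  proof (rule sum.mono_neutral_right[OF J])
    show "\<forall>x\<in>J - {u - 1, u}. t (flip u X) x - t X x = 0"
    proof
      fix x assume "x \<in> J - {u - 1, u}"
      then have "x \<noteq> u" "x + 1 \<noteq> u" by auto
      then show "t (flip u X) x - t X x = 0" by (simp add: t_def flip_def)
    qed
  qed (simp add: J_def)
  finally show ?thesis by (auto simp: t_def flip_def of_bool_def)
qed

text \<open>
  A flip next to an interface either moves the interface by one step, or, if the flipped site is a
  block of its own, annihilates its two interfaces.
\<close>

lemma interface_sum_flip_at_interface:
  assumes "finite (interfaces X)" "x \<in> interfaces X"
  shows "interface_sum w (flip x X) - interface_sum w X =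
      (if X (x - 1) = X x then w (x - 1) (X x) else - w (x - 1) (\<not> X x)) - w x (X x)"
    and "interface_sum w (flip (x + 1) X) - interface_sum w X =
      (if X (x + 2) = X (x + 1) then w (x + 1) (X x) else - w (x + 1) (\<not> X x)) - w x (X x)"
  using assms(2)
  by (cases "X x"; cases "X (x - 1)"; cases "X (x + 2)";
      simp add: interface_sum_flip[OF assms(1)] interfaces_def add.assoc)+

lemma interface_sum_nonneg:
  "(\<And>x i. 0 \<le> w x i) \<Longrightarrow> 0 \<le> interface_sum w X"
  by (simp add: interface_sum_def sum_nonneg)

lemma interface_sum_Lipschitz:
  assumes "finite (interfaces X)" "\<And>x i. 0 \<le> w x i" "\<And>x i. w x i \<le> C"
  shows "\<bar>interface_sum w (flip u X) - interface_sum w X\<bar> \<le> 2 * C"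
  using assms(2,3)[of "u - 1" "X (u - 1)"] assms(2,3)[of u "X u"] assms(2,3)[of u "\<not> X u"]
  by (auto simp: interface_sum_flip[OF assms(1)] of_bool_def abs_le_iff)

context cVMBC_flow
begin

text \<open>
  Only sites next to an interface flip, so the generator is a sum over interfaces, and a bound of
  its value reduces to the four sites around a single interface.
\<close>

lemma gen_eq_interface_sum:
  assumes "finite (interfaces X)"
  shows "gen F X = (\<Sum>x\<in>interfaces X. pushes 1 X x * (F (flip x X) - F X)
    + pushes (-1) X (x + 1) * (F (flip (x + 1) X) - F X))"
proof -
  define I where "I = interfaces X"
  define D where "D = I \<union> (\<lambda>x. x + 1) ` I"
  define \<delta> where "\<delta> u = F (flip u X) - F X" for u
  have fin: "finite I" "finite D" using assms by (auto simp: I_def D_def)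
  have p: "pushes 1 X u = 0" if "u \<notin> I" for u
    using that by (simp add: I_def interfaces_def push_def)
  have m: "pushes (-1) X u = 0" if "u \<notin> (\<lambda>x. x + 1) ` I" for u
  proof -
    have "u - 1 \<notin> I" using that by force
    then show ?thesis by (simp add: I_def interfaces_def push_def)
  qed
  have "gen F X = (\<Sum>u\<in>D. rate u X * \<delta> u)"
    unfolding \<delta>_def using fin p m
    by (intro spin_pregenerator_eq_sum) (auto simp: D_def cVMBC_rate_eq_push)
  also have "\<dots> = (\<Sum>u\<in>D. pushes 1 X u * \<delta> u) + (\<Sum>u\<in>D. pushes (-1) X u * \<delta> u)"
    by (simp add: cVMBC_rate_eq_push distrib_right sum.distrib)
  also have "(\<Sum>u\<in>D. pushes 1 X u * \<delta> u) = (\<Sum>u\<in>I. pushes 1 X u * \<delta> u)"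
    using fin p by (intro sum.mono_neutral_right) (auto simp: D_def)
  also have "(\<Sum>u\<in>D. pushes (-1) X u * \<delta> u) = (\<Sum>u\<in>(\<lambda>x. x + 1) ` I. pushes (-1) X u * \<delta> u)"
    using fin m by (intro sum.mono_neutral_right) (auto simp: D_def)
  also have "\<dots> = (\<Sum>x\<in>I. pushes (-1) X (x + 1) * \<delta> (x + 1))"
    by (subst sum.reindex) (auto simp: inj_on_def)
  finally show ?thesis
    by (simp add: I_def \<delta>_def sum.distrib)
qed

section \<open>Extinction of the finite type\<close>

text \<open>
  The number of perturbed sites alone is not a supermartingale when these are defectors: a lone
  cooperator between two blocks of defectors lacks the help of a second cooperator. But such a
  block disappears at rate at least 1, and the term for the interfaces rewards its disappearance.
\<close>

definition energy :: "bool \<Rightarrow> int config \<Rightarrow> real" where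
  "energy b X = perturbation b X + interface_sum (\<lambda>_ _. \<gamma> / 2) X"

lemma energy_nonneg: "0 \<le> energy b X"
  using \<gamma> by (simp add: energy_def perturbation_def interface_sum_nonneg)

lemma energy_flip_at_interface:
  assumes "finite {x. X x \<noteq> b}" "x \<in> interfaces X"
  shows "energy b (flip x X) - energy b X
      = (if X x = b then 1 else -1) - \<gamma> * of_bool (X (x - 1) \<noteq> X x)"
    and "energy b (flip (x + 1) X) - energy b X
      = (if X (x + 1) = b then 1 else -1) - \<gamma> * of_bool (X (x + 2) \<noteq> X (x + 1))"
  using perturbation_flip[OF assms(1), of x] perturbation_flip[OF assms(1), of "x + 1"]
    interface_sum_flip_at_interface[OF finite_interfaces[OF assms(1)] assms(2), of "\<lambda>_ _. \<gamma> / 2"]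
  by (auto simp: energy_def)

lemma energy_Lipschitz:
  assumes "finite {x. X x \<noteq> b}"
  shows "\<bar>energy b (flip u X) - energy b X\<bar> \<le> 1 + \<gamma>"
  using perturbation_flip[OF assms, of u] \<gamma>
    interface_sum_Lipschitz[OF finite_interfaces[OF assms], of "\<lambda>_ _. \<gamma> / 2" "\<gamma> / 2" u]
  by (auto simp: energy_def abs_le_iff split: if_splits)

definition background_favored :: "bool \<Rightarrow> bool" where
  "background_favored b \<longleftrightarrow> (if b then \<alpha> \<le> \<gamma> else \<gamma> \<le> \<alpha>)"

lemma energy_drift_at_interface:
  assumes "background_favored b" "finite {x. X x \<noteq> b}" "x \<in> interfaces X"
  shows "pushes 1 X x * (energy b (flip x X) - energy b X)
    + pushes (-1) X (x + 1) * (energy b (flip (x + 1) X) - energy b X) \<le> 0"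
proof -
  have nonneg: "0 \<le> \<alpha> * (\<gamma> * 2)" "0 \<le> \<gamma> * (\<gamma> * 2)"
    and nonneg': "0 \<le> \<alpha> * \<gamma>" "0 \<le> \<gamma> * \<gamma>" using \<alpha> \<gamma> by auto
  have inter: "X (x + 1) = (\<not> X x)" "x + 1 + 2 * -1 = x - 1" "x + 1 + -1 = x"
    using assms(3) by (auto simp: interfaces_def)
  show ?thesis
  proof (cases b)
    case True
    then have le: "\<alpha> \<le> \<gamma>" using assms(1) by (simp add: background_favored_def)
    show ?thesis
      unfolding energy_flip_at_interface[OF assms(2,3)] push_def inter
      by (cases "X x"; cases "X (x - 1)"; cases "X (x + 2)";
          simp add: True algebra_simps; (simp add: field_simps)?;
          use le nonneg in linarith)
  next
    case False
    then have le: "\<gamma> \<le> \<alpha>" using assms(1) by (simp add: background_favored_def)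
    show ?thesis
      unfolding energy_flip_at_interface[OF assms(2,3)] push_def inter
      by (cases "X x"; cases "X (x - 1)"; cases "X (x + 2)";
          simp add: False algebra_simps; (simp add: field_simps)?;
          use le nonneg' \<alpha> \<gamma> in linarith)
  qed
qed

lemma gen_energy_nonpos:
  assumes "background_favored b" "finite {x. X x \<noteq> b}"
  shows "gen (energy b) X \<le> 0"
  unfolding gen_eq_interface_sum[OF finite_interfaces[OF assms(2)]]
  by (intro sum_nonpos energy_drift_at_interface assms)

text \<open>
  A concave function of the energy, which therefore decreases strictly on average, even at
  \<open>\<alpha> = \<gamma>\<close>, where the energy of one long block is a martingale.
\<close>

definition saturated_energy :: "bool \<Rightarrow> int config \<Rightarrow> real" where
  "saturated_energy b X = energy b X / (1 + energy b X)"

lemma saturated_energy_bounds: "0 \<le> saturated_energy b X" "saturated_energy b X \<le> 1"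
  using energy_nonneg[of b X] by (auto simp: saturated_energy_def)

text \<open>Taylor's formula of order 2, with an exact remainder.\<close>

lemma saturation_increment:
  fixes e \<delta> :: real
  assumes "0 \<le> e" "0 \<le> e + \<delta>"
  shows "(e + \<delta>) / (1 + (e + \<delta>)) - e / (1 + e) =
    \<delta> / (1 + e)\<^sup>2 - \<delta>\<^sup>2 / ((1 + e)\<^sup>2 * (1 + e + \<delta>))"
proof -
  have "1 + e \<noteq> 0" "1 + e + \<delta> \<noteq> 0" using assms by auto
  then show ?thesis by (simp add: divide_simps power2_eq_square) (simp add: algebra_simps)
qed

text \<open>
  Next to each interface there is a perturbed site. Its flip has rate at least \<open>1 / 2\<close> and lowers the
  energy by at least 1; the bound is the contribution of this flip to the remainder.
\<close>

lemma saturated_drift_at_interface: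
  assumes "background_favored b" "finite {x. X x \<noteq> b}" "x \<in> interfaces X"
  shows "pushes 1 X x * (saturated_energy b (flip x X) - saturated_energy b X)
    + pushes (-1) X (x + 1) * (saturated_energy b (flip (x + 1) X) - saturated_energy b X)
    \<le> - 1 / (2 * (1 + energy b X) ^ 3)"
proof -
  define e where "e = energy b X"
  define \<delta>1 where "\<delta>1 = energy b (flip x X) - e"
  define \<delta>2 where "\<delta>2 = energy b (flip (x + 1) X) - e"
  define p where "p = pushes 1 X x"
  define q where "q = pushes (-1) X (x + 1)"
  have e: "0 \<le> e" "0 \<le> e + \<delta>1" "0 \<le> e + \<delta>2"
    using energy_nonneg by (auto simp: e_def \<delta>1_def \<delta>2_def)
  have inter: "X (x + 1) = (\<not> X x)" using assms(3) by (auto simp: interfaces_def)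
  have pq: "1 / 2 \<le> p" "1 / 2 \<le> q"
    using \<alpha> \<gamma> inter by (auto simp: p_def q_def push_def)
  have "\<delta>1 \<le> -1 \<or> \<delta>2 \<le> -1"
    using energy_flip_at_interface[OF assms(2,3)] inter \<gamma>
    by (cases "X x = b") (auto simp: \<delta>1_def \<delta>2_def e_def)
  moreover have loss: "1 / (2 * (1 + e) ^ 3) \<le> r * (\<delta>\<^sup>2 / ((1 + e)\<^sup>2 * (1 + e + \<delta>)))"
    if "\<delta> \<le> -1" "0 \<le> e + \<delta>" "1 / 2 \<le> r" for \<delta> r
  proof -
    have "1 \<le> \<delta>\<^sup>2" using power_mono[of 1 "- \<delta>" 2] that by simp
    have "1 / (1 + e) ^ 3 \<le> \<delta>\<^sup>2 / ((1 + e)\<^sup>2 * (1 + e + \<delta>))"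
    proof (rule frac_le)
      have "(1 + e)\<^sup>2 * (1 + e + \<delta>) \<le> (1 + e)\<^sup>2 * (1 + e)"
        using that by (intro mult_left_mono) auto
      then show "(1 + e)\<^sup>2 * (1 + e + \<delta>) \<le> (1 + e) ^ 3"
        by (simp add: power2_eq_square power3_eq_cube mult.assoc)
      show "0 < (1 + e)\<^sup>2 * (1 + e + \<delta>)"
        using e(1) that by (intro mult_pos_pos) auto
    qed (use \<open>1 \<le> \<delta>\<^sup>2\<close> in auto)
    moreover have "0 \<le> 1 / (1 + e) ^ 3" using e(1) by simp
    ultimately have "1 / 2 * (1 / (1 + e) ^ 3) \<le> r * (\<delta>\<^sup>2 / ((1 + e)\<^sup>2 * (1 + e + \<delta>)))"
      using that by (intro mult_mono) auto
    then show ?thesis by simp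
  qed
  moreover have "0 \<le> r * (\<delta>\<^sup>2 / ((1 + e)\<^sup>2 * (1 + e + \<delta>)))" if "0 \<le> e + \<delta>" "1 / 2 \<le> r" for \<delta> r
    using that e(1) by simp
  ultimately have loss: "1 / (2 * (1 + e) ^ 3) \<le> p * (\<delta>1\<^sup>2 / ((1 + e)\<^sup>2 * (1 + e + \<delta>1)))
      + q * (\<delta>2\<^sup>2 / ((1 + e)\<^sup>2 * (1 + e + \<delta>2)))"
    using e pq by (smt (verit))
  have inc: "saturated_energy b (flip x X) - saturated_energy b X
      = \<delta>1 / (1 + e)\<^sup>2 - \<delta>1\<^sup>2 / ((1 + e)\<^sup>2 * (1 + e + \<delta>1))"
    "saturated_energy b (flip (x + 1) X) - saturated_energy b X
      = \<delta>2 / (1 + e)\<^sup>2 - \<delta>2\<^sup>2 / ((1 + e)\<^sup>2 * (1 + e + \<delta>2))"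
    using saturation_increment[OF e(1,2)] saturation_increment[OF e(1,3)]
    by (simp_all add: saturated_energy_def \<delta>1_def \<delta>2_def e_def)
  have "p * \<delta>1 + q * \<delta>2 \<le> 0"
    using energy_drift_at_interface[OF assms] by (simp add: p_def q_def \<delta>1_def \<delta>2_def e_def)
  then have "(p * \<delta>1 + q * \<delta>2) / (1 + e)\<^sup>2 \<le> 0"
    by (simp add: divide_nonpos_nonneg)
  then show ?thesis
    using loss unfolding inc by (simp add: p_def[symmetric] q_def[symmetric] e_def[symmetric]
        right_diff_distrib add_divide_distrib)
qed

lemma gen_saturated_energy:
  assumes "background_favored b" "finite {x. X x \<noteq> b}"
  shows "gen (saturated_energy b) X \<le> - of_bool (X \<noteq> (\<lambda>_. b)) / (2 * (1 + energy b X) ^ 3)"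
proof -
  let ?d = "1 / (2 * (1 + energy b X) ^ 3)"
  note fin = finite_interfaces[OF assms(2)]
  have d: "0 \<le> ?d" using energy_nonneg[of b X] by simp
  have "gen (saturated_energy b) X \<le> real (card (interfaces X)) * (- ?d)"
    unfolding gen_eq_interface_sum[OF fin]
    by (intro sum_bounded_above) (use saturated_drift_at_interface[OF assms] in simp)
  also have "\<dots> \<le> - of_bool (X \<noteq> (\<lambda>_. b)) * ?d"
  proof (cases "X = (\<lambda>_. b)")
    case True
    then show ?thesis using d by simp
  next
    case False
    then have "1 \<le> card (interfaces X)"
      using interfaces_nonempty[OF assms(2)] fin by (simp add: Suc_le_eq card_gt_0_iff)
    then have "1 * ?d \<le> real (card (interfaces X)) * ?d"
      using d by (intro mult_right_mono) auto
    with False show ?thesis by simp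
  qed
  finally show ?thesis by simp
qed

lemma saturated_energy_Lipschitz: "\<bar>saturated_energy b X - saturated_energy b Y\<bar> \<le> 1"
  using saturated_energy_bounds[of b X] saturated_energy_bounds[of b Y] by linarith

section \<open>Every window clears\<close>

definition dirty :: "bool \<Rightarrow> nat \<Rightarrow> int config \<Rightarrow> real" where
  "dirty b L X = of_bool (\<exists>x. \<bar>x\<bar> \<le> int L \<and> X x \<noteq> b)"

lemma dirty_eq_patch: "dirty b L X = of_bool (patch b L X \<noteq> (\<lambda>_. b))"
  by (auto simp: dirty_def patch_def fun_eq_iff)

lemma dirty_bcontfun: "dirty b L \<in> bcontfun"
proof -
  have "dirty b L = (\<lambda>X. of_bool (patch b L X \<noteq> (\<lambda>_. b)))"
    by (rule ext) (rule dirty_eq_patch)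
  then show ?thesis
    using cylinder_bcontfun[OF cylinder_patch[of "\<lambda>Y. of_bool (Y \<noteq> (\<lambda>_. b))" b L]] by simp
qed

text \<open>A window stays clear for a while if it lies well inside a window that is clear now.\<close>

lemma expect_dirty_le:
  assumes t: "0 \<le> t"
  shows "expect t \<zeta> (dirty b L0)
    \<le> dirty b (L0 + k) \<zeta> + (2 * real L0 + 1) * ((max_rate * t) ^ k / fact k)"
proof (cases "\<exists>x. \<bar>x\<bar> \<le> int (L0 + k) \<and> \<zeta> x \<noteq> b")
  case True
  have "expect t \<zeta> (dirty b L0) \<le> expect t \<zeta> (\<lambda>_. 1)"
    by (intro expect_mono t dirty_bcontfun const_bcontfun) (simp add: dirty_def)
  moreover have "0 \<le> (2 * real L0 + 1) * ((max_rate * t) ^ k / fact k)"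
    using t max_rate_pos by simp
  ultimately show ?thesis using True t by (simp add: dirty_def expect_const)
next
  case False
  let ?W = "{- int L0..int L0}"
  have bc: "differs b x \<in> bcontfun" for x
    by (intro cylinder_bcontfun cylinder_differs)
  have "dirty b L0 X \<le> (\<Sum>x\<in>?W. differs b x X)" for X
  proof (cases "\<exists>x. \<bar>x\<bar> \<le> int L0 \<and> X x \<noteq> b")
    case True
    then obtain x where "\<bar>x\<bar> \<le> int L0" "X x \<noteq> b" by blast
    then have x: "x \<in> ?W" "X x \<noteq> b" by (auto simp: abs_le_iff)
    then have "differs b x X \<le> (\<Sum>x\<in>?W. differs b x X)"
      by (intro member_le_sum) auto
    with x show ?thesis by (simp add: dirty_def)
  next
    case False
    then show ?thesis by (auto simp: dirty_def intro: sum_nonneg)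
  qed
  then have "expect t \<zeta> (dirty b L0) \<le> expect t \<zeta> (\<lambda>X. \<Sum>x\<in>?W. differs b x X)"
    using expect_sum[OF t, of ?W "differs b" \<zeta>] bc
    by (intro expect_mono t dirty_bcontfun) auto
  also have "\<dots> = (\<Sum>x\<in>?W. expect t \<zeta> (differs b x))"
    using expect_sum[OF t, of ?W "differs b" \<zeta>] bc by auto
  also have "\<dots> \<le> real (card ?W) * ((max_rate * t) ^ k / fact k)"
  proof (rule sum_bounded_above)
    fix x assume x: "x \<in> ?W"
    show "expect t \<zeta> (differs b x) \<le> (max_rate * t) ^ k / fact k"
    proof (rule expect_differs_le[OF t])
      fix y assume "\<bar>y - x\<bar> < int k"
      then have "\<bar>y\<bar> \<le> int (L0 + k)" using x by auto
      then show "\<zeta> y = b" using False by blast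
    qed
  qed
  finally show ?thesis using False by (auto simp: dirty_def algebra_simps)
qed

lemma leak_mono: "0 \<le> s \<Longrightarrow> s \<le> t \<Longrightarrow> leak s n \<le> leak t n"
  using max_rate_pos unfolding leak_def
  by (intro mult_left_mono divide_right_mono power_mono) auto

lemma energy_patch_le:
  assumes "background_favored b" "\<And>y. int m < \<bar>y\<bar> \<Longrightarrow> \<eta> y = b" "0 \<le> s"
  shows "expect s \<eta> (\<lambda>X. energy b (patch b (m + n) X)) \<le> energy b \<eta> + s * ((1 + \<gamma>) * leak s n)"
proof -
  have "expect s \<eta> (\<lambda>X. energy b (patch b (m + n) X))
      \<le> energy b \<eta> + (0 - 0) + s * ((1 + \<gamma>) * leak s n)"
  proof (rule expect_patch_le[OF energy_Lipschitz assms(2,3)])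
    fix r :: real assume r: "0 < r" "r < s"
    have "expect r \<eta> (\<lambda>X. gen (energy b) (patch b (m + n) X)) \<le> expect r \<eta> (\<lambda>_. 0)"
      using r by (intro expect_mono cylinder_bcontfun cylinder_patch const_bcontfun
          gen_energy_nonpos assms(1) finite_patch) auto
    then show "expect r \<eta> (\<lambda>X. gen (energy b) (patch b (m + n) X)) \<le> 0"
      using r by (simp add: expect_const)
  qed (auto intro: derivative_eq_intros)
  then show ?thesis by simp
qed

text \<open>
  Up to a small probability, the window can be dirty at time \<open>T\<close> only if a larger window was dirty
  at each earlier time. At that time the energy is at most \<open>K\<close>, up to a probability of
  \<open>energy b \<eta> / K\<close>, and then the saturated energy loses at least \<open>1 / (2 * (1 + K) ^ 3)\<close> per unit
  of time. In total it loses at most 1.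
\<close>

lemma window_clears:
  assumes dom: "background_favored b" and \<eta>: "\<And>y. int m < \<bar>y\<bar> \<Longrightarrow> \<eta> y = b" and T: "0 < T" and K: "0 < K"
  shows "expect T \<eta> (dirty b L0) \<le> energy b \<eta> / K + 2 * (1 + K) ^ 3 / T"
proof -
  define w where "w = expect T \<eta> (dirty b L0)"
  define C where "C = 2 * (1 + K) ^ 3"
  have C: "0 < C" using K by (simp add: C_def)
  define small where "small n = (2 * real L0 + 1) * ((max_rate * T) ^ (m + n) / fact (m + n))" for n
  define en where "en n = T * ((1 + \<gamma>) * leak T (L0 + n))" for n
  let ?sat = "saturated_energy b"
  have main: "w \<le> small n + (energy b \<eta> + en n) / K + C * (1 / T + leak T (L0 + n))" for n
  proof -
    define L where "L = m + (L0 + n)"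
    define \<mu> where "\<mu> = (w - small n - (energy b \<eta> + en n) / K) / C"
    let ?G = "\<lambda>X. gen ?sat (patch b L X)"
    let ?E = "\<lambda>X. energy b (patch b L X)"
    have bc: "?G \<in> bcontfun" "?E \<in> bcontfun"
      by (intro cylinder_bcontfun cylinder_patch)+
    have bc': "(\<lambda>X. - C * ?G X) \<in> bcontfun" "(\<lambda>X. 1 / K * ?E X) \<in> bcontfun"
      using scaleR_cont[OF bc(1), of "- C"] scaleR_cont[OF bc(2), of "1 / K"] by simp_all
    have point: "dirty b L X \<le> - C * ?G X + 1 / K * ?E X" for X
    proof (cases "patch b L X = (\<lambda>_. b)")
      case True
      then have "?G X \<le> 0"
        using gen_saturated_energy[OF dom finite_patch, of L X] by simp
      then have "0 \<le> - C * ?G X" using C by (simp add: mult_nonneg_nonpos)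
      moreover have "0 \<le> 1 / K * ?E X" using K energy_nonneg by simp
      ultimately show ?thesis using True by (simp add: dirty_eq_patch)
    next
      case False
      let ?e = "?E X"
      have e: "0 \<le> ?e" by (rule energy_nonneg)
      have "?G X \<le> - (1 / (2 * (1 + ?e) ^ 3))"
        using gen_saturated_energy[OF dom finite_patch, of L X] False by simp
      then have G: "C * (1 / (2 * (1 + ?e) ^ 3)) \<le> - C * ?G X"
        using C mult_left_mono[of "?G X" "- (1 / (2 * (1 + ?e) ^ 3))" C] by simp
      have "1 \<le> - C * ?G X + 1 / K * ?e"
      proof (cases "?e \<le> K")
        case True
        have "1 \<le> C * (1 / (2 * (1 + ?e) ^ 3))"
          using True e power_mono[of "1 + ?e" "1 + K" 3] by (simp add: C_def)
        moreover have "0 \<le> 1 / K * ?e" using K e by simp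
        ultimately show ?thesis using G by linarith
      next
        case False
        then have "1 \<le> 1 / K * ?e" using K by simp
        moreover have "0 \<le> C * (1 / (2 * (1 + ?e) ^ 3))" using C e by simp
        ultimately show ?thesis using G by linarith
      qed
      then show ?thesis using False by (simp add: dirty_eq_patch)
    qed
    have drift: "expect s \<eta> ?G \<le> - \<mu>" if s: "0 < s" "s < T" for s
    proof -
      have s0: "0 \<le> s" using s by simp
      have "w = expect s \<eta> (\<lambda>\<zeta>. expect (T - s) \<zeta> (dirty b L0))"
        using expect_Chapman_Kolmogorov[of s "T - s" \<eta> "dirty b L0"] s by (simp add: w_def)
      also have "\<dots> \<le> expect s \<eta> (\<lambda>\<zeta>. dirty b L \<zeta> + small n)"
      proof (intro expect_mono expect_bcontfun plus_cont dirty_bcontfun const_bcontfun s0)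
        fix \<zeta>
        have "expect (T - s) \<zeta> (dirty b L0)
            \<le> dirty b (L0 + (m + n)) \<zeta> + (2 * real L0 + 1) * ((max_rate * (T - s)) ^ (m + n) / fact (m + n))"
          using s by (intro expect_dirty_le) auto
        also have "\<dots> \<le> dirty b L \<zeta> + small n"
          unfolding small_def L_def using s max_rate_pos
          by (intro add_mono mult_left_mono divide_right_mono power_mono) (auto simp: algebra_simps)
        finally show "expect (T - s) \<zeta> (dirty b L0) \<le> dirty b L \<zeta> + small n" .
      qed
      also have "\<dots> = expect s \<eta> (dirty b L) + small n"
        using expect_add[OF s0 dirty_bcontfun const_bcontfun] by (simp add: expect_const s0)
      also have "expect s \<eta> (dirty b L) \<le> expect s \<eta> (\<lambda>X. - C * ?G X + 1 / K * ?E X)"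
        by (intro expect_mono s0 dirty_bcontfun plus_cont bc' point)
      also have "\<dots> = - C * expect s \<eta> ?G + 1 / K * expect s \<eta> ?E"
        by (simp only: expect_add[OF s0 bc'] expect_cmult[OF s0 bc(1)] expect_cmult[OF s0 bc(2)])
      also have "1 / K * expect s \<eta> ?E \<le> 1 / K * (energy b \<eta> + en n)"
      proof (intro mult_left_mono)
        have "expect s \<eta> ?E \<le> energy b \<eta> + s * ((1 + \<gamma>) * leak s (L0 + n))"
          unfolding L_def by (rule energy_patch_le[OF dom \<eta> s0])
        also have "s * ((1 + \<gamma>) * leak s (L0 + n)) \<le> en n"
          unfolding en_def using s \<gamma> max_rate_pos
          by (intro mult_mono leak_mono) (auto simp: leak_def)
        finally show "expect s \<eta> ?E \<le> energy b \<eta> + en n" by simp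
      qed (use K in simp)
      finally have "C * expect s \<eta> ?G \<le> - (w - small n - (energy b \<eta> + en n) / K)" by simp
      then show ?thesis using C by (simp add: \<mu>_def field_simps)
    qed
    have "0 = expect T \<eta> (\<lambda>_. 0)" using T by (simp add: expect_const)
    also have "\<dots> \<le> expect T \<eta> (\<lambda>X. ?sat (patch b L X))"
      using T saturated_energy_bounds
      by (intro expect_mono const_bcontfun cylinder_bcontfun cylinder_patch) auto
    also have "\<dots> \<le> ?sat \<eta> + (- \<mu> * T - - \<mu> * 0) + T * (1 * leak T (L0 + n))"
      unfolding L_def
    proof (rule expect_patch_le[OF saturated_energy_Lipschitz \<eta>, where h = "\<lambda>_. - \<mu>"])
      show "continuous_on {0..T} (\<lambda>s. - \<mu> * s)" by (intro continuous_intros)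
      show "((\<lambda>s. - \<mu> * s) has_real_derivative - \<mu>) (at s)" for s
        by (auto intro!: derivative_eq_intros)
      show "expect s \<eta> (\<lambda>X. gen ?sat (patch b (m + (L0 + n)) X)) \<le> - \<mu>" if "0 < s" "s < T" for s
        using drift[OF that] by (simp only: L_def)
    qed (use T in auto)
    also have "\<dots> \<le> 1 - \<mu> * T + T * leak T (L0 + n)"
      using saturated_energy_bounds(2)[of b \<eta>] by simp
    finally have "\<mu> \<le> 1 / T + leak T (L0 + n)"
      using T by (simp add: field_simps)
    then have "C * \<mu> \<le> C * (1 / T + leak T (L0 + n))"
      using C by (intro mult_left_mono) auto
    moreover have "C * \<mu> = w - small n - (energy b \<eta> + en n) / K"
      using C by (simp add: \<mu>_def)
    ultimately show ?thesis by simp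
  qed
  have leak0: "(\<lambda>n. leak T (L0 + n)) \<longlonglongrightarrow> 0"
    using LIMSEQ_ignore_initial_segment[OF leak_tendsto_0, of T L0] by (simp add: add.commute)
  have "small \<longlonglongrightarrow> (2 * real L0 + 1) * 0"
    unfolding small_def[abs_def]
    using LIMSEQ_ignore_initial_segment[OF power_over_fact_tendsto_0[of "max_rate * T"], of m]
    by (intro tendsto_intros) (simp add: add.commute)
  moreover have "en \<longlonglongrightarrow> T * ((1 + \<gamma>) * 0)"
    unfolding en_def[abs_def] by (intro tendsto_intros leak0)
  ultimately have "(\<lambda>n. small n + (energy b \<eta> + en n) / K + C * (1 / T + leak T (L0 + n)))
      \<longlonglongrightarrow> (2 * real L0 + 1) * 0 + (energy b \<eta> + T * ((1 + \<gamma>) * 0)) / K + C * (1 / T + 0)"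
    using K by (intro tendsto_intros leak0) auto
  then have "w \<le> (2 * real L0 + 1) * 0 + (energy b \<eta> + T * ((1 + \<gamma>) * 0)) / K + C * (1 / T + 0)"
    using main by (intro LIMSEQ_le_const) auto
  then show ?thesis by (simp add: w_def C_def)
qed

section \<open>Interfaces leave every bounded region\<close>

text \<open>
  Away from other interfaces, an interface performs a random walk whose two rates are in the ratio
  \<open>\<rho> = (1 + \<alpha>) / (1 + \<gamma>)\<close>, so \<open>\<rho>\<^sup>x\<close> and 1 are harmonic for it. Their minimum is bounded and
  superharmonic, strictly so only at 0: if \<open>\<alpha> \<noteq> \<gamma>\<close>, it is a multiple of the Green function of this
  walk at 0.
\<close>

definition drift_ratio :: real where
  "drift_ratio = (1 + \<alpha>) / (1 + \<gamma>)"

definition green :: "int \<Rightarrow> real" where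
  "green z = min 1 (drift_ratio powi z)"

lemma green_bounds: "0 \<le> green z" "green z \<le> 1"
  using \<alpha> \<gamma> by (auto simp: green_def drift_ratio_def)

lemma green_superharmonic:
  "(1 + \<alpha>) * (green (z - 1) - green z) + (1 + \<gamma>) * (green (z + 1) - green z)
    \<le> - \<bar>\<gamma> - \<alpha>\<bar> * of_bool (z = 0)"
proof -
  define a where "a = 1 + \<alpha>"
  define g where "g = 1 + \<gamma>"
  define p where "p = drift_ratio powi z"
  have pos: "0 < a" "0 < g" using \<alpha> \<gamma> by (auto simp: a_def g_def)
  then have p0: "0 < p" by (simp add: p_def drift_ratio_def a_def g_def)
  have \<rho>: "drift_ratio \<noteq> 0" "drift_ratio = a / g"
    using pos by (auto simp: drift_ratio_def a_def g_def)
  have up: "green (z + 1) = min 1 (p * (a / g))" and down: "green (z - 1) = min 1 (p * (g / a))"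
    using \<rho> by (auto simp: green_def p_def power_int_add power_int_diff)
  have here: "green z = min 1 p" by (simp add: green_def p_def)
  have "a * (green (z - 1) - green z) + g * (green (z + 1) - green z)
      \<le> - \<bar>g - a\<bar> * of_bool (z = 0)"
  proof (cases "z = 0")
    case True
    then have "p = 1" by (simp add: p_def)
    show ?thesis
    proof (cases "a \<le> g")
      case True
      have "a * min 1 (g / a) \<le> a" "g * min 1 (a / g) \<le> a"
        using pos mult_left_mono[of "min 1 (g / a)" 1 a] mult_left_mono[of "min 1 (a / g)" "a / g" g]
        by auto
      then show ?thesis using \<open>z = 0\<close> True
        unfolding up down here \<open>p = 1\<close> using pos by (simp add: right_diff_distrib)
    next
      case False
      have "a * min 1 (g / a) \<le> g" "g * min 1 (a / g) \<le> g"
        using pos mult_left_mono[of "min 1 (g / a)" "g / a" a] mult_left_mono[of "min 1 (a / g)" 1 g]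
        by auto
      then show ?thesis using \<open>z = 0\<close> False
        unfolding up down here \<open>p = 1\<close> using pos by (simp add: right_diff_distrib)
    qed
  next
    case False
    have "a * (green (z - 1) - green z) + g * (green (z + 1) - green z) \<le> 0"
    proof (cases "p \<le> 1")
      case True
      have "a * green (z - 1) \<le> a * (p * (g / a))" "g * green (z + 1) \<le> g * (p * (a / g))"
        unfolding up down using pos by (intro mult_left_mono; simp)+
      then show ?thesis using True pos by (simp add: here algebra_simps)
    next
      case False
      have "a * green (z - 1) \<le> a * 1" "g * green (z + 1) \<le> g * 1"
        using pos green_bounds by (intro mult_left_mono; simp)+
      then show ?thesis using False by (simp add: here algebra_simps)
    qed
    with False show ?thesis by simp
  qed
  then show ?thesis by (simp add: a_def g_def)
qed

text \<open>
  The extra weight \<open>max_rate\<close> of each interface is lost at annihilation. This loss compensates for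
  the perturbed rates of an interface that is next to another one.
\<close>

definition exit_weight :: "int \<Rightarrow> int \<Rightarrow> bool \<Rightarrow> real" where
  "exit_weight x0 x i = max_rate + green (if i then x - x0 else x0 - x)"

lemma exit_weight_bounds:
  "max_rate \<le> exit_weight x0 x i" "exit_weight x0 x i \<le> max_rate + 1" "0 \<le> exit_weight x0 x i"
  using green_bounds[of "if i then x - x0 else x0 - x"] max_rate_pos
  by (auto simp: exit_weight_def)

lemma exit_drift_at_interface:
  assumes "finite (interfaces X)" "x \<in> interfaces X"
  shows "pushes 1 X x * (interface_sum (exit_weight x0) (flip x X) - interface_sum (exit_weight x0) X)
    + pushes (-1) X (x + 1)
      * (interface_sum (exit_weight x0) (flip (x + 1) X) - interface_sum (exit_weight x0) X)
    \<le> - (\<bar>\<gamma> - \<alpha>\<bar> / 2) * of_bool (x = x0)"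
proof -
  define w where "w = exit_weight x0"
  have inter: "X (x + 1) = (\<not> X x)" using assms(2) by (auto simp: interfaces_def)
  define q where "q \<longleftrightarrow> X (x - 1) = X x"
  define p where "p \<longleftrightarrow> X (x + 2) = (\<not> X x)"
  define l where "l = pushes 1 X x"
  define r where "r = pushes (-1) X (x + 1)"
  have lr: "1 / 2 \<le> l" "1 / 2 \<le> r" "l \<le> max_rate / 2" "r \<le> max_rate / 2"
    using \<alpha> \<gamma> inter push_le[of 1 X x] push_le[of "-1" X "x + 1"]
    by (auto simp: l_def r_def push_def)
  have drift: "\<bar>\<gamma> - \<alpha>\<bar> / 2 * of_bool (x = x0) \<le> max_rate / 2"
    using \<alpha> \<gamma> by (auto simp: max_rate_def)
  define D1 where "D1 = (if q then w (x - 1) (X x) else - w (x - 1) (\<not> X x)) - w x (X x)"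
  define D2 where "D2 = (if p then w (x + 1) (X x) else - w (x + 1) (\<not> X x)) - w x (X x)"
  \<comment> \<open>A step changes the Green function by at most 1, an annihilation costs at least
    \<open>2 * max_rate\<close>.\<close>
  have move: "D \<le> 1" if "D = w y i - w z j" for D y z i j
    using that exit_weight_bounds[of x0 y i] exit_weight_bounds[of x0 z j] by (auto simp: w_def)
  have die: "s * D \<le> - max_rate" if "D = - w y i - w z j" "1 / 2 \<le> s" for D y z i j s
  proof -
    have "D \<le> - 2 * max_rate"
      using that exit_weight_bounds[of x0 y i] exit_weight_bounds[of x0 z j] by (auto simp: w_def)
    then have "s * D \<le> s * (- 2 * max_rate)"
      using that by (intro mult_left_mono) auto
    also have "\<dots> \<le> 1 / 2 * (- 2 * max_rate)"
      using that max_rate_pos by (intro mult_right_mono_neg) auto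
    finally show ?thesis by simp
  qed
  have step: "s * D \<le> max_rate / 2" if "D \<le> 1" "1 / 2 \<le> s" "s \<le> max_rate / 2" for s D :: real
  proof -
    have "s * D \<le> s * 1" using that by (intro mult_left_mono) auto
    with that(3) show ?thesis by linarith
  qed
  have "l * D1 + r * D2 \<le> - (\<bar>\<gamma> - \<alpha>\<bar> / 2) * of_bool (x = x0)"
  proof (cases "q \<and> p")
    case True
    then have sites: "X (x - 1) = X x" "X (x + 2) = (\<not> X x)" by (auto simp: p_def q_def)
    show ?thesis
    proof (cases "X x")
      case True
      then have "l = (1 + \<alpha>) / 2" "r = (1 + \<gamma>) / 2"
        using sites inter by (auto simp: l_def r_def push_def)
      then have lr: "l * D1 + r * D2 = ((1 + \<alpha>) * D1 + (1 + \<gamma>) * D2) / 2"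
        by (simp add: add_divide_distrib algebra_simps)
      have D: "D1 = green ((x - x0) - 1) - green (x - x0)"
        "D2 = green ((x - x0) + 1) - green (x - x0)"
        using \<open>q \<and> p\<close> True by (simp_all add: D1_def D2_def w_def exit_weight_def algebra_simps)
      have "(1 + \<alpha>) * D1 + (1 + \<gamma>) * D2 \<le> - \<bar>\<gamma> - \<alpha>\<bar> * of_bool (x - x0 = 0)"
        unfolding D using green_superharmonic[of "x - x0"] by linarith
      then show ?thesis unfolding lr by auto
    next
      case False
      then have "l = (1 + \<gamma>) / 2" "r = (1 + \<alpha>) / 2"
        using sites inter by (auto simp: l_def r_def push_def)
      then have lr: "l * D1 + r * D2 = ((1 + \<gamma>) * D1 + (1 + \<alpha>) * D2) / 2"
        by (simp add: add_divide_distrib algebra_simps)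
      have D: "D1 = green ((x0 - x) + 1) - green (x0 - x)"
        "D2 = green ((x0 - x) - 1) - green (x0 - x)"
        using \<open>q \<and> p\<close> False by (simp_all add: D1_def D2_def w_def exit_weight_def algebra_simps)
      have "(1 + \<gamma>) * D1 + (1 + \<alpha>) * D2 \<le> - \<bar>\<gamma> - \<alpha>\<bar> * of_bool (x0 - x = 0)"
        unfolding D using green_superharmonic[of "x0 - x"] by linarith
      then show ?thesis unfolding lr by auto
    qed
  next
    case False
    have 1: "l * D1 \<le> (if q then max_rate / 2 else - max_rate)"
      using step[of D1 l] move[of D1 "x - 1" "X x" x "X x"] die[of D1 "x - 1" "\<not> X x" x "X x" l] lr
      by (auto simp: D1_def)
    have 2: "r * D2 \<le> (if p then max_rate / 2 else - max_rate)"
      using step[of D2 r] move[of D2 "x + 1" "X x" x "X x"] die[of D2 "x + 1" "\<not> X x" x "X x" r] lr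
      by (auto simp: D2_def)
    show ?thesis using False 1 2 drift max_rate_pos by (auto split: if_splits)
  qed
  moreover have "interface_sum w (flip x X) - interface_sum w X = D1"
    "interface_sum w (flip (x + 1) X) - interface_sum w X = D2"
    using interface_sum_flip_at_interface[OF assms, of w] inter by (simp_all add: D1_def D2_def q_def p_def)
  ultimately show ?thesis
    by (simp add: w_def l_def r_def)
qed

lemma gen_exit_weight:
  assumes "finite (interfaces X)"
  shows "gen (interface_sum (exit_weight x0)) X
    \<le> - (\<bar>\<gamma> - \<alpha>\<bar> / 2) * of_bool (X x0 \<noteq> X (x0 + 1))"
proof -
  have "gen (interface_sum (exit_weight x0)) X
      \<le> (\<Sum>x\<in>interfaces X. - (\<bar>\<gamma> - \<alpha>\<bar> / 2) * of_bool (x = x0))"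
    unfolding gen_eq_interface_sum[OF assms]
    by (intro sum_mono exit_drift_at_interface assms)
  also have "\<dots> = - (\<bar>\<gamma> - \<alpha>\<bar> / 2) * (\<Sum>x\<in>interfaces X. of_bool (x = x0))"
    by (simp only: sum_distrib_left)
  also have "(\<Sum>x\<in>interfaces X. of_bool (x = x0)) = (of_bool (x0 \<in> interfaces X) :: real)"
    using assms by (simp add: of_bool_def)
  finally show ?thesis by (simp add: interfaces_def)
qed

end

text \<open>
  Barbalat's lemma: if \<open>a\<close> stays above \<open>\<epsilon>\<close> at late times, then, being Lipschitz, it contributes a
  fixed amount to the integral again and again.
\<close>

lemma tendsto_0_if_Lipschitz_and_integral_bounded:
  fixes a :: "real \<Rightarrow> real"
  assumes nonneg: "\<And>t. 0 \<le> t \<Longrightarrow> 0 \<le> a t"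
    and K: "0 < K" "\<And>s t. 0 \<le> s \<Longrightarrow> s \<le> t \<Longrightarrow> \<bar>a t - a s\<bar> \<le> K * (t - s)"
    and cont: "\<And>T. continuous_on {0..T} a"
    and bound: "\<And>T. 0 \<le> T \<Longrightarrow> integral {0..T} a \<le> C"
  shows "(a \<longlongrightarrow> 0) at_top"
proof -
  let ?A = "\<lambda>T. integral {0..T} a"
  have int: "a integrable_on {s..t}" if "0 \<le> s" for s t
    by (rule integrable_continuous_real, rule continuous_on_subset[OF cont[of t]]) (use that in auto)
  have split: "?A t - ?A s = integral {s..t} a" if "0 \<le> s" "s \<le> t" for s t
    using Henstock_Kurzweil_Integration.integral_combine[of 0 s t a] that int[of 0 t] by simp
  have mono: "?A s \<le> ?A t" if "0 \<le> s" "s \<le> t" for s t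
  proof -
    have "0 \<le> integral {s..t} a"
      using that nonneg by (intro integral_nonneg int) auto
    then show ?thesis using split[OF that] by simp
  qed
  let ?R = "?A ` {0..}"
  have bdd: "bdd_above ?R" using bound by (auto simp: bdd_above_def)
  show ?thesis
  proof (rule tendstoI)
    fix \<epsilon> :: real assume \<epsilon>: "0 < \<epsilon>"
    define h where "h = \<epsilon> / (2 * K)"
    have h: "0 < h" "K * h = \<epsilon> / 2" using \<epsilon> K by (auto simp: h_def)
    have "Sup ?R - h * (\<epsilon> / 2) < Sup ?R" using h \<epsilon> by simp
    then obtain T where T: "0 \<le> T" "Sup ?R - h * (\<epsilon> / 2) < ?A T"
      using less_cSup_iff[OF _ bdd, of "Sup ?R - h * (\<epsilon> / 2)"] by auto
    have "dist (a t) 0 < \<epsilon>" if "T \<le> t" for t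
    proof -
      have t: "0 \<le> t" using T that by simp
      have "h * (a t - \<epsilon> / 2) = integral {t..t + h} (\<lambda>_. a t - \<epsilon> / 2)"
        using h by simp
      also have "\<dots> \<le> integral {t..t + h} a"
      proof (rule integral_le[OF _ int[OF t]])
        fix s assume s: "s \<in> {t..t + h}"
        then have "K * (s - t) \<le> K * h" using K by (intro mult_left_mono) auto
        then show "a t - \<epsilon> / 2 \<le> a s"
          using K(2)[OF t, of s] s h by auto
      qed (intro integrable_continuous_real continuous_on_const)
      also have "\<dots> = ?A (t + h) - ?A t" using split[of t "t + h"] t h by simp
      also have "\<dots> \<le> Sup ?R - ?A T"
        using cSup_upper[OF _ bdd, of "?A (t + h)"] mono[OF T(1) that] t h by auto
      also have "\<dots> < h * (\<epsilon> / 2)" using T by simp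
      finally have "a t < \<epsilon>" using h by simp
      then show ?thesis using nonneg[OF t] by simp
    qed
    then show "\<forall>\<^sub>F t in at_top. dist (a t) 0 < \<epsilon>"
      unfolding eventually_at_top_linorder by blast
  qed
qed

context cVMBC_flow
begin

theorem expect_interface_tendsto_0:
  assumes "\<alpha> \<noteq> \<gamma>" and fin: "finite {x. \<eta> x \<noteq> b}"
  shows "((\<lambda>t. expect t \<eta> (\<lambda>X. of_bool (X x0 \<noteq> X (x0 + 1)))) \<longlongrightarrow> 0) at_top"
proof -
  let ?f = "\<lambda>X :: int config. of_bool (X x0 \<noteq> X (x0 + 1)) :: real"
  let ?F = "interface_sum (exit_weight x0)"
  define a where "a t = expect t \<eta> ?f" for t
  define d where "d = \<bar>\<gamma> - \<alpha>\<bar> / 2"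
  have d: "0 < d" using assms by (simp add: d_def)
  have cyl: "cylinder ?f"
    by (rule cylinderI[of "{x0, x0 + 1}"]) auto
  note bc = cylinder_bcontfun[OF cyl]
  obtain m0 where m0: "\<And>y. int m0 < \<bar>y\<bar> \<Longrightarrow> \<eta> y = b"
    using finite_perturbation_in_window[OF fin] by blast
  define m where "m = max m0 (nat (\<bar>x0\<bar> + 1))"
  have m: "\<bar>x0\<bar> + 1 \<le> int m" "\<And>y. int m < \<bar>y\<bar> \<Longrightarrow> \<eta> y = b"
    using m0 by (auto simp: m_def)
  have Lip: "\<bar>?F (flip u Y) - ?F Y\<bar> \<le> 2 * (max_rate + 1)" if "finite {x. Y x \<noteq> b}" for Y u
    using exit_weight_bounds by (intro interface_sum_Lipschitz finite_interfaces[OF that])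
  have cont: "continuous_on {0..T} a" for T
    unfolding a_def by (intro expect_continuous bc)
  have bound: "d * integral {0..T} a \<le> ?F \<eta>" if T: "0 \<le> T" for T
  proof -
    let ?H = "\<lambda>s. - d * integral {0..s} a"
    have "- d * 0 - ?H T \<le> ?F \<eta> + T * (2 * (max_rate + 1) * leak T n)" for n
    proof -
      have "expect T \<eta> (\<lambda>X. ?F (patch b (m + n) X))
          \<le> ?F \<eta> + (?H T - ?H 0) + T * (2 * (max_rate + 1) * leak T n)"
      proof (rule expect_patch_le[OF Lip m(2) T])
        show "continuous_on {0..T} ?H"
          by (intro continuous_intros indefinite_integral_continuous_1 integrable_continuous_real cont)
        fix s assume s: "0 < s" "s < T"
        have "((\<lambda>s. integral {0..s} a) has_real_derivative a s) (at s within {0..T})"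
          using s by (intro integral_has_real_derivative cont) auto
        moreover have "at s within {0..T} = at s"
          using s by (intro at_within_interior) (auto simp: interior_atLeastAtMost_real)
        ultimately have "((\<lambda>s. integral {0..s} a) has_real_derivative a s) (at s)" by simp
        from DERIV_cmult[OF this, of "- d"]
        show "(?H has_real_derivative - d * a s) (at s)" by simp
        have "gen ?F (patch b (m + n) X) \<le> - d * ?f X" for X
        proof -
          have "patch b (m + n) X x0 = X x0" "patch b (m + n) X (x0 + 1) = X (x0 + 1)"
            using m(1) by (auto simp: patch_def)
          then show ?thesis
            using gen_exit_weight[OF finite_interfaces[OF finite_patch[of b "m + n" X]], of x0]
            by (simp add: d_def)
        qed
        then have "expect s \<eta> (\<lambda>X. gen ?F (patch b (m + n) X)) \<le> expect s \<eta> (\<lambda>X. - d * ?f X)"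
          using s scaleR_cont[OF bc, of "- d"]
          by (intro expect_mono cylinder_bcontfun[OF cylinder_patch]) auto
        then show "expect s \<eta> (\<lambda>X. gen ?F (patch b (m + n) X)) \<le> - d * a s"
          using expect_cmult[OF _ bc, of s \<eta> "- d"] s by (simp add: a_def)
      qed
      moreover have "expect T \<eta> (\<lambda>_. 0) \<le> expect T \<eta> (\<lambda>X. ?F (patch b (m + n) X))"
        using exit_weight_bounds T
        by (intro expect_mono const_bcontfun cylinder_bcontfun cylinder_patch interface_sum_nonneg)
      ultimately show ?thesis using T by (simp add: expect_const)
    qed
    moreover have "(\<lambda>n. ?F \<eta> + T * (2 * (max_rate + 1) * leak T n))
        \<longlonglongrightarrow> ?F \<eta> + T * (2 * (max_rate + 1) * 0)"
      by (intro tendsto_intros leak_tendsto_0)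
    ultimately have "- d * 0 - ?H T \<le> ?F \<eta> + T * (2 * (max_rate + 1) * 0)"
      by (intro LIMSEQ_le_const) auto
    then show ?thesis by simp
  qed
  obtain K where K: "0 < K" "\<And>s t. 0 \<le> s \<Longrightarrow> s \<le> t \<Longrightarrow> \<bar>a t - a s\<bar> \<le> K * (t - s)"
    unfolding a_def using expect_Lipschitz[OF cyl, of \<eta>] by blast
  have "(a \<longlongrightarrow> 0) at_top"
  proof (rule tendsto_0_if_Lipschitz_and_integral_bounded[OF _ K cont])
    fix t :: real assume t: "0 \<le> t"
    then show "integral {0..t} a \<le> ?F \<eta> / d"
      using bound d by (simp add: field_simps)
    have "expect t \<eta> (\<lambda>_. 0) \<le> a t"
      unfolding a_def using t by (intro expect_mono const_bcontfun bc) auto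
    then show "0 \<le> a t" using t by (simp add: expect_const)
  qed
  then show ?thesis by (simp add: a_def[abs_def])
qed

end

section \<open>From the semigroup to the paths\<close>

locale started_cVMBC = cVMBC_flow \<alpha> \<gamma> S + prob_space M
  for \<alpha> \<gamma> :: real and S and M :: "'w measure" +
  fixes X :: "real \<Rightarrow> 'w \<Rightarrow> int config" and \<eta> :: "int config" and b :: bool
  assumes X_measurable: "\<And>t. 0 \<le> t \<Longrightarrow> X t \<in> borel_measurable M"
    and X_cadlag: "\<And>\<omega>. \<omega> \<in> space M \<Longrightarrow> cadlag (\<lambda>t. X t \<omega>)"
    and X_Markov: "\<And>f s t. 0 \<le> s \<Longrightarrow> 0 \<le> t \<Longrightarrow>
      AE \<omega> in M. real_cond_exp M (past M X s) (\<lambda>\<omega>'. apply_bcontfun f (X (s + t) \<omega>')) \<omega>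
        = apply_bcontfun (S t f) (X s \<omega>)"
    and finite_start: "finite {x. \<eta> x \<noteq> b}"
    and X_start: "AE \<omega> in M. X 0 \<omega> = \<eta>"
begin

lemma site_measurable:
  assumes "0 \<le> t"
  shows "(\<lambda>\<omega>. X t \<omega> u) \<in> measurable M (count_space UNIV)"
proof -
  have "(\<lambda>x :: int config. x u) \<in> borel_measurable borel"
    by (intro borel_measurable_continuous_onI continuous_on_product_coordinates)
  from measurable_compose[OF X_measurable[OF assms] this]
  have "(\<lambda>\<omega>. X t \<omega> u) \<in> borel_measurable M" .
  moreover have "sets (borel :: bool measure) = sets (count_space UNIV)"
    by (simp add: sets_borel_eq_count_space)
  ultimately show ?thesis using measurable_cong_sets by blast
qed

lemma site_sets [measurable]: "0 \<le> t \<Longrightarrow> Measurable.pred M (\<lambda>\<omega>. X t \<omega> u)"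
  by (rule site_measurable)

lemma bcontfun_X:
  fixes f :: "int config \<Rightarrow> real"
  assumes "0 \<le> t" "f \<in> bcontfun"
  shows "integrable M (\<lambda>\<omega>. f (X t \<omega>))"
proof -
  obtain B where B: "\<And>x. norm (f x) \<le> B"
    using assms(2) by (auto simp: bcontfun_def bounded_iff)
  have "f \<in> borel_measurable borel"
    using assms(2) by (intro borel_measurable_continuous_onI) (simp add: bcontfun_def)
  from measurable_compose[OF X_measurable[OF assms(1)] this]
  show ?thesis
    by (intro integrable_const_bound[of _ B]) (use B in auto)
qed

lemma past_subalgebra:
  assumes "0 \<le> s"
  shows "subalgebra M (past M X s)"
proof -
  let ?G = "\<Union>r\<in>{0..s}. {X r -` B \<inter> space M | B. B \<in> sets borel}"
  have "?G \<subseteq> events"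
    using X_measurable by (auto intro: measurable_sets)
  moreover have "?G \<subseteq> Pow (space M)" by auto
  ultimately show ?thesis
    unfolding subalgebra_def past_def
    by (simp add: space_measure_of_conv sets_measure_of sets.sigma_sets_subset)
qed

lemma past_sigma_finite:
  assumes "0 \<le> s"
  shows "sigma_finite_subalgebra M (past M X s)"
  by (rule finite_measure_subalgebra_is_sigma_finite)
    (unfold_locales, rule past_subalgebra[OF assms])

lemma integral_eq_expect:
  assumes t: "0 \<le> t" and f: "f \<in> bcontfun"
  shows "(\<integral>\<omega>. f (X t \<omega>) \<partial>M) = expect t \<eta> f"
proof -
  interpret F: sigma_finite_subalgebra M "past M X 0" by (rule past_sigma_finite) simp
  let ?c = "real_cond_exp M (past M X 0) (\<lambda>\<omega>. f (X t \<omega>))"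
  have "AE \<omega> in M. ?c \<omega> = expect t (X 0 \<omega>) f"
    using X_Markov[of 0 t "Bcontfun f"] t f by (simp add: Bcontfun_inverse expect_def)
  then have "AE \<omega> in M. ?c \<omega> = expect t \<eta> f"
    using X_start by eventually_elim simp
  then have "(\<integral>\<omega>. ?c \<omega> \<partial>M) = (\<integral>\<omega>. expect t \<eta> f \<partial>M)"
    by (intro integral_cong_AE) auto
  then show ?thesis
    using F.real_cond_exp_int(2)[OF bcontfun_X[OF t f]] by (simp add: prob_space)
qed

lemma prob_eq_expect:
  assumes t: "0 \<le> t" and f: "(\<lambda>x. of_bool (P x) :: real) \<in> bcontfun"
  shows "prob {\<omega> \<in> space M. P (X t \<omega>)} = expect t \<eta> (\<lambda>x. of_bool (P x))"
    and "{\<omega> \<in> space M. P (X t \<omega>)} \<in> events"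
proof -
  have int: "integrable M (\<lambda>\<omega>. of_bool (P (X t \<omega>)) :: real)"
    by (rule bcontfun_X[OF t f])
  then have "(\<lambda>\<omega>. of_bool (P (X t \<omega>)) :: real) \<in> borel_measurable M" by simp
  then have "(\<lambda>\<omega>. of_bool (P (X t \<omega>)) :: real) -` {1} \<inter> space M \<in> events"
    by (rule measurable_sets) simp
  also have "(\<lambda>\<omega>. of_bool (P (X t \<omega>)) :: real) -` {1} \<inter> space M = {\<omega> \<in> space M. P (X t \<omega>)}"
    by auto
  finally show ev: "{\<omega> \<in> space M. P (X t \<omega>)} \<in> events" .
  have "prob {\<omega> \<in> space M. P (X t \<omega>)} = (\<integral>\<omega>. indicator {\<omega> \<in> space M. P (X t \<omega>)} \<omega> \<partial>M)"
    using ev by simp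
  also have "\<dots> = (\<integral>\<omega>. of_bool (P (X t \<omega>)) \<partial>M)"
    by (intro Bochner_Integration.integral_cong) (auto simp: indicator_def)
  finally show "prob {\<omega> \<in> space M. P (X t \<omega>)} = expect t \<eta> (\<lambda>x. of_bool (P x))"
    using integral_eq_expect[OF t f] by simp
qed

lemma closed_background: "closed {\<lambda>_ :: int. b}"
proof -
  have "{\<lambda>_ :: int. b} = (\<Inter>u. (\<lambda>x. x u) -` {b})"
    by auto
  moreover have "closed \<dots>"
    by (intro closed_INT ballI closed_vimage continuous_on_product_coordinates) simp
  ultimately show ?thesis by simp
qed

text \<open>No perturbation arrives from any finite distance.\<close>

lemma expect_background:
  assumes "0 \<le> t"
  shows "expect t (\<lambda>_. b) (differs b u) = 0"
proof -
  have "expect t (\<lambda>_. b) (differs b u) \<le> (max_rate * t) ^ n / fact n" for n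
    by (rule expect_differs_le[OF assms]) simp
  then have "expect t (\<lambda>_. b) (differs b u) \<le> 0"
    by (intro LIMSEQ_le_const[OF power_over_fact_tendsto_0]) auto
  moreover have "expect t (\<lambda>_. b) (\<lambda>_. 0) \<le> expect t (\<lambda>_. b) (differs b u)"
    by (intro expect_mono assms const_bcontfun cylinder_bcontfun cylinder_differs) simp
  ultimately show ?thesis using assms by (simp add: expect_const)
qed

text \<open>
  The constant configuration is absorbing: the Markov property gives this for each later time,
  hence for all rational ones, and right continuity for all.
\<close>

lemma background_absorbing_at:
  assumes s: "0 \<le> s" and t: "0 \<le> t"
  shows "AE \<omega> in M. X s \<omega> = (\<lambda>_. b) \<longrightarrow> X (s + t) \<omega> u = b"
proof -
  interpret F: sigma_finite_subalgebra M "past M X s" by (rule past_sigma_finite[OF s])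
  define A where "A = X s -` {\<lambda>_. b} \<inter> space M"
  let ?f = "\<lambda>\<omega>. differs b u (X (s + t) \<omega>)"
  have A: "A \<in> sets (past M X s)"
  proof -
    have "A \<in> (\<Union>r\<in>{0..s}. {X r -` B \<inter> space M | B. B \<in> sets borel})"
      unfolding A_def using s closed_background by (auto intro!: bexI[of _ s])
    then show ?thesis
      unfolding past_def by (subst sets_measure_of) auto
  qed
  have AM: "A \<in> events"
    using A past_subalgebra[OF s] by (auto simp: subalgebra_def)
  have bc: "differs b u \<in> bcontfun"
    by (intro cylinder_bcontfun cylinder_differs)
  have st: "0 \<le> s + t" using s t by simp
  have int: "integrable M ?f" by (rule bcontfun_X[OF st bc])
  then have int': "integrable M (\<lambda>\<omega>. indicator A \<omega> * ?f \<omega>)"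
    using integrable_mult_indicator[OF AM int] by simp
  have "(\<integral>\<omega>. indicator A \<omega> * ?f \<omega> \<partial>M)
      = (\<integral>\<omega>. indicator A \<omega> * real_cond_exp M (past M X s) ?f \<omega> \<partial>M)"
    using A int int' by (intro F.real_cond_exp_intg(2)[symmetric]) auto
  also have "\<dots> = (\<integral>\<omega>. 0 \<partial>M)"
  proof (rule integral_cong_AE)
    have "AE \<omega> in M. real_cond_exp M (past M X s) ?f \<omega> = expect t (X s \<omega>) (differs b u)"
      using X_Markov[OF s t, of "Bcontfun (differs b u)"] bc
      by (simp add: Bcontfun_inverse expect_def)
    then show "AE \<omega> in M. indicator A \<omega> * real_cond_exp M (past M X s) ?f \<omega> = 0"
      by eventually_elim (use expect_background[OF t, of u] in \<open>auto simp: A_def indicator_def\<close>)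
  qed (use AM in auto)
  finally have "(\<integral>\<omega>. indicator A \<omega> * ?f \<omega> \<partial>M) = 0" by simp
  then have "AE \<omega> in M. indicator A \<omega> * ?f \<omega> = 0"
    using integral_nonneg_eq_0_iff_AE[OF int'] by simp
  then show ?thesis
    using AE_space by eventually_elim (auto simp: A_def)
qed

lemma locally_constant_right:
  assumes "\<omega> \<in> space M" "0 \<le> t"
  obtains d where "t < d" "\<And>r. t < r \<Longrightarrow> r < d \<Longrightarrow> X r \<omega> u = X t \<omega> u"
proof -
  have "((\<lambda>t. X t \<omega>) \<longlongrightarrow> X t \<omega>) (at_right t)"
    using X_cadlag assms by (simp add: cadlag_def)
  then have "((\<lambda>t. X t \<omega> u) \<longlongrightarrow> X t \<omega> u) (at_right t)"
    using continuous_on_tendsto_compose[OF continuous_on_product_coordinates[of u]] by auto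
  then have "\<forall>\<^sub>F r in at_right t. X r \<omega> u = X t \<omega> u"
    by (simp add: tendsto_discrete)
  then show thesis
    using that by (auto simp: eventually_at_right_field)
qed

lemma background_absorbing:
  assumes s: "0 \<le> s"
  shows "AE \<omega> in M. X s \<omega> = (\<lambda>_. b) \<longrightarrow> (\<forall>t\<ge>s. \<forall>u. X t \<omega> u = b)"
proof -
  have "AE \<omega> in M. \<forall>u. \<forall>q :: rat. 0 \<le> q \<longrightarrow> X s \<omega> = (\<lambda>_. b) \<longrightarrow> X (s + of_rat q) \<omega> u = b"
    unfolding AE_all_countable using background_absorbing_at[OF s] by auto
  then show ?thesis
    using AE_space
  proof eventually_elim
    case (elim \<omega>)
    show ?case
    proof (intro impI allI)
      fix t u assume X: "X s \<omega> = (\<lambda>_. b)" and t: "s \<le> t"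
      obtain d where d: "t < d" "\<And>r. t < r \<Longrightarrow> r < d \<Longrightarrow> X r \<omega> u = X t \<omega> u"
        using locally_constant_right[OF elim(2), of t u] s t by auto
      obtain q where q: "t - s < of_rat q" "of_rat q < d - s"
        using of_rat_dense[of "t - s" "d - s"] d(1) by auto
      have "0 < (of_rat q :: real)" using q(1) t by linarith
      then have "X (s + of_rat q) \<omega> u = b" using elim(1) X by (simp add: less_imp_le)
      then show "X t \<omega> u = b" using d(2)[of "s + of_rat q"] q by simp
    qed
  qed
qed

text \<open>
  By right continuity the limit is determined by the rational times, so it is a countable
  combination of events.
\<close>

lemma limit_event: "{\<omega> \<in> space M. ((\<lambda>t. X t \<omega> u) \<longlongrightarrow> b) at_top} \<in> events"
proof -
  \<comment> \<open>The maximum with 0 keeps every time in the range where the process is measurable.\<close>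
  have "((\<lambda>t. X t \<omega> u) \<longlongrightarrow> b) at_top \<longleftrightarrow>
      (\<exists>n :: nat. \<forall>q :: rat. real n \<le> of_rat q \<longrightarrow> X (max 0 (of_rat q)) \<omega> u = b)"
    if \<omega>: "\<omega> \<in> space M" for \<omega>
  proof
    assume "((\<lambda>t. X t \<omega> u) \<longlongrightarrow> b) at_top"
    then obtain T where T: "\<And>t. T \<le> t \<Longrightarrow> X t \<omega> u = b"
      by (auto simp: tendsto_discrete eventually_at_top_linorder)
    obtain n :: nat where "T \<le> real n" using real_arch_simple by blast
    then show "\<exists>n :: nat. \<forall>q :: rat. real n \<le> of_rat q \<longrightarrow> X (max 0 (of_rat q)) \<omega> u = b"
      by (intro exI[of _ n]) (auto intro!: T)
  next
    assume "\<exists>n :: nat. \<forall>q :: rat. real n \<le> of_rat q \<longrightarrow> X (max 0 (of_rat q)) \<omega> u = b"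
    then obtain n :: nat where n: "\<And>q :: rat. real n \<le> of_rat q \<Longrightarrow> X (of_rat q) \<omega> u = b"
      by (metis max.absorb2 of_nat_0_le_iff order_trans)
    have "X t \<omega> u = b" if t: "real n \<le> t" for t
    proof -
      obtain d where d: "t < d" "\<And>r. t < r \<Longrightarrow> r < d \<Longrightarrow> X r \<omega> u = X t \<omega> u"
        using locally_constant_right[OF \<omega>, of t u] order_trans[OF _ t, of 0] by auto
      obtain q where q: "t < of_rat q" "of_rat q < d"
        using of_rat_dense[OF d(1)] by auto
      then show ?thesis using d(2)[OF q] n[of q] t by simp
    qed
    then show "((\<lambda>t. X t \<omega> u) \<longlongrightarrow> b) at_top"
      by (auto simp: tendsto_discrete eventually_at_top_linorder)
  qed
  then have "{\<omega> \<in> space M. ((\<lambda>t. X t \<omega> u) \<longlongrightarrow> b) at_top} =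
      {\<omega> \<in> space M. \<exists>n :: nat. \<forall>q :: rat. real n \<le> of_rat q \<longrightarrow> X (max 0 (of_rat q)) \<omega> u = b}"
    by blast
  also have "\<dots> \<in> events"
    by measurable
  finally show ?thesis .
qed

lemma background_event: "0 \<le> t \<Longrightarrow> {\<omega> \<in> space M. X t \<omega> = (\<lambda>_. b)} \<in> events"
  using measurable_sets[OF X_measurable, of t "{\<lambda>_. b}"] closed_background
  by (simp add: vimage_def Int_def conj_commute)

text \<open>The bound of \<open>window_clears\<close> is uniform in the window, which can be the whole line.\<close>

lemma prob_not_background_le:
  assumes dom: "background_favored b" and t: "0 < t" and K: "0 < K"
  shows "prob {\<omega> \<in> space M. X t \<omega> \<noteq> (\<lambda>_. b)} \<le> energy b \<eta> / K + 2 * (1 + K) ^ 3 / t"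
proof -
  obtain m where m: "\<And>y. int m < \<bar>y\<bar> \<Longrightarrow> \<eta> y = b"
    using finite_perturbation_in_window[OF finite_start] by blast
  let ?D = "\<lambda>L x. \<exists>y. \<bar>y\<bar> \<le> int L \<and> x y \<noteq> b"
  define A where "A L = {\<omega> \<in> space M. ?D L (X t \<omega>)}" for L
  have bc: "(\<lambda>x. of_bool (?D L x) :: real) \<in> bcontfun" for L
    using dirty_bcontfun[of b L] by (simp add: dirty_def[abs_def])
  have A: "A L \<in> events" "prob (A L) \<le> energy b \<eta> / K + 2 * (1 + K) ^ 3 / t" for L
  proof -
    have "expect t \<eta> (dirty b L) \<le> energy b \<eta> / K + 2 * (1 + K) ^ 3 / t"
      by (rule window_clears[OF dom m t K])
    then show "A L \<in> events" "prob (A L) \<le> energy b \<eta> / K + 2 * (1 + K) ^ 3 / t"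
      using prob_eq_expect[OF _ bc, of t L] t by (simp_all add: A_def dirty_def[abs_def])
  qed
  have "incseq A"
    by (rule incseq_SucI) (force simp: A_def)
  then have "(\<lambda>L. prob (A L)) \<longlonglongrightarrow> prob (\<Union>L. A L)"
    using A(1) by (intro finite_Lim_measure_incseq) auto
  moreover have "(\<Union>L. A L) = {\<omega> \<in> space M. X t \<omega> \<noteq> (\<lambda>_. b)}"
  proof -
    have "\<exists>L. ?D L x" if "x \<noteq> (\<lambda>_. b)" for x :: "int config"
    proof -
      have "\<exists>y. x y \<noteq> b" using that ext[of x "\<lambda>_. b"] by blast
      then obtain y where "x y \<noteq> b" by blast
      then show ?thesis by (intro exI[of _ "nat \<bar>y\<bar>"] exI[of _ y]) simp
    qed
    then show ?thesis by (auto simp: A_def)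
  qed
  ultimately show ?thesis
    using A(2) by (intro LIMSEQ_le_const2[where X = "\<lambda>L. prob (A L)"]) auto
qed

lemma prob_not_background_tendsto_0:
  assumes "background_favored b"
  shows "((\<lambda>t. prob {\<omega> \<in> space M. X t \<omega> \<noteq> (\<lambda>_. b)}) \<longlongrightarrow> 0) at_top"
proof (rule tendstoI)
  fix \<epsilon> :: real assume \<epsilon>: "0 < \<epsilon>"
  define e where "e = energy b \<eta>"
  have e: "0 \<le> e" by (simp add: e_def energy_nonneg)
  define K where "K = 2 * (e + 1) / \<epsilon>"
  have K: "0 < K" using \<epsilon> e by (simp add: K_def)
  have eK: "e / K < \<epsilon> / 2" using \<epsilon> e by (simp add: K_def field_simps)
  define T where "T = 4 * (1 + K) ^ 3 / \<epsilon> + 1"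
  have T: "0 < T" using \<epsilon> K by (simp add: T_def add_pos_pos)
  have "dist (prob {\<omega> \<in> space M. X t \<omega> \<noteq> (\<lambda>_. b)}) 0 < \<epsilon>" if "T \<le> t" for t
  proof -
    have t: "0 < t" using T that by simp
    have "4 * (1 + K) ^ 3 / \<epsilon> < t" using that by (simp add: T_def)
    then have "2 * (1 + K) ^ 3 / t < \<epsilon> / 2"
      using \<epsilon> t by (simp add: field_simps)
    then have "prob {\<omega> \<in> space M. X t \<omega> \<noteq> (\<lambda>_. b)} < \<epsilon>"
      using prob_not_background_le[OF assms t K] eK unfolding e_def by linarith
    then show ?thesis by simp
  qed
  then show "\<forall>\<^sub>F t in at_top. dist (prob {\<omega> \<in> space M. X t \<omega> \<noteq> (\<lambda>_. b)}) 0 < \<epsilon>"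
    unfolding eventually_at_top_linorder by blast
qed

lemma prob_limit_background:
  assumes "background_favored b"
  shows "prob {\<omega> \<in> space M. ((\<lambda>t. X t \<omega> u) \<longlongrightarrow> b) at_top} = 1"
proof -
  let ?E = "{\<omega> \<in> space M. ((\<lambda>t. X t \<omega> u) \<longlongrightarrow> b) at_top}"
  have "1 - prob ?E \<le> prob {\<omega> \<in> space M. X t \<omega> \<noteq> (\<lambda>_. b)}" if t: "0 \<le> t" for t
  proof -
    have "AE \<omega> in M. \<omega> \<in> {\<omega> \<in> space M. X t \<omega> = (\<lambda>_. b)} \<longrightarrow> \<omega> \<in> ?E"
      using background_absorbing[OF t] AE_space
    proof eventually_elim
      case (elim \<omega>)
      show ?case
      proof
        assume "\<omega> \<in> {\<omega> \<in> space M. X t \<omega> = (\<lambda>_. b)}"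
        then have "\<forall>r\<ge>t. X r \<omega> u = b" using elim by simp
        then show "\<omega> \<in> ?E"
          using elim(2) by (auto simp: tendsto_discrete eventually_at_top_linorder)
      qed
    qed
    then have "prob {\<omega> \<in> space M. X t \<omega> = (\<lambda>_. b)} \<le> prob ?E"
      using limit_event by (intro finite_measure_mono_AE) auto
    moreover have "prob {\<omega> \<in> space M. X t \<omega> \<noteq> (\<lambda>_. b)} = 1 - prob {\<omega> \<in> space M. X t \<omega> = (\<lambda>_. b)}"
      using prob_neg[OF background_event[OF t]] by simp
    ultimately show ?thesis by simp
  qed
  then have "1 - prob ?E \<le> 0"
    by (intro tendsto_lowerbound[OF prob_not_background_tendsto_0[OF assms]])
      (auto simp: eventually_at_top_linorder)
  then show ?thesis using prob_le_1[of ?E] by linarith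
qed

lemma neighbors_agree:
  "((\<lambda>t. prob {\<omega> \<in> space M. X t \<omega> x \<noteq> X t \<omega> (x + 1)}) \<longlongrightarrow> 0) at_top"
proof (cases "background_favored b")
  case True
  show ?thesis
  proof (rule tendsto_sandwich[OF _ _ tendsto_const prob_not_background_tendsto_0[OF True]])
    show "\<forall>\<^sub>F t in at_top. prob {\<omega> \<in> space M. X t \<omega> x \<noteq> X t \<omega> (x + 1)}
        \<le> prob {\<omega> \<in> space M. X t \<omega> \<noteq> (\<lambda>_. b)}"
      using eventually_ge_at_top[of 0]
    proof eventually_elim
      case (elim t)
      have "space M - {\<omega> \<in> space M. X t \<omega> = (\<lambda>_. b)} \<in> events"
        using background_event[OF elim] by auto
      also have "space M - {\<omega> \<in> space M. X t \<omega> = (\<lambda>_. b)} = {\<omega> \<in> space M. X t \<omega> \<noteq> (\<lambda>_. b)}"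
        by auto
      finally show ?case by (intro finite_measure_mono) auto
    qed
  qed simp
next
  case False
  then have "\<alpha> \<noteq> \<gamma>" by (auto simp: background_favored_def)
  from expect_interface_tendsto_0[OF this finite_start, of x]
  show ?thesis
  proof (rule Lim_transform_eventually)
    have bc: "(\<lambda>X :: int config. of_bool (X x \<noteq> X (x + 1)) :: real) \<in> bcontfun"
      by (rule cylinder_bcontfun, rule cylinderI[of "{x, x + 1}"]) auto
    show "\<forall>\<^sub>F t in at_top. expect t \<eta> (\<lambda>X. of_bool (X x \<noteq> X (x + 1)))
        = prob {\<omega> \<in> space M. X t \<omega> x \<noteq> X t \<omega> (x + 1)}"
      using eventually_ge_at_top[of 0] by eventually_elim (rule prob_eq_expect(1)[OF _ bc, symmetric])
  qed
qed

lemma sites_agree: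
  "((\<lambda>t. prob {\<omega> \<in> space M. X t \<omega> u \<noteq> X t \<omega> (u + int n)}) \<longlongrightarrow> 0) at_top"
proof (induction n)
  case 0
  then show ?case by simp
next
  case (Suc n)
  let ?v = "u + int n"
  let ?p = "\<lambda>t x y. prob {\<omega> \<in> space M. X t \<omega> x \<noteq> X t \<omega> y}"
  have sum: "((\<lambda>t. ?p t u ?v + ?p t ?v (?v + 1)) \<longlongrightarrow> 0) at_top"
    using tendsto_add[OF Suc neighbors_agree[of ?v]] by simp
  show ?case
  proof (rule tendsto_sandwich[OF _ _ tendsto_const sum])
    show "\<forall>\<^sub>F t in at_top. ?p t u (u + int (Suc n)) \<le> ?p t u ?v + ?p t ?v (?v + 1)"
      using eventually_ge_at_top[of 0]
    proof eventually_elim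
      case (elim t)
      note [measurable] = site_sets[OF elim]
      have "?p t u (u + int (Suc n))
          \<le> prob ({\<omega> \<in> space M. X t \<omega> u \<noteq> X t \<omega> ?v} \<union> {\<omega> \<in> space M. X t \<omega> ?v \<noteq> X t \<omega> (?v + 1)})"
        by (intro finite_measure_mono) (auto simp: algebra_simps)
      also have "\<dots> \<le> ?p t u ?v + ?p t ?v (?v + 1)"
        by (intro measure_Un_le) auto
      finally show ?case .
    qed
  qed simp
qed

lemma process_clusters: "clusters M X"
  unfolding clusters_def
proof (intro allI)
  have le: "((\<lambda>t. prob {\<omega> \<in> space M. X t \<omega> u = X t \<omega> v}) \<longlongrightarrow> 1) at_top" if "u \<le> v" for u v
  proof -
    have v: "u + int (nat (v - u)) = v" using that by simp
    have "((\<lambda>t. 1 - prob {\<omega> \<in> space M. X t \<omega> u \<noteq> X t \<omega> v}) \<longlongrightarrow> 1 - 0) at_top"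
      using sites_agree[of u "nat (v - u)"] unfolding v by (intro tendsto_intros)
    moreover have "\<forall>\<^sub>F t in at_top. 1 - prob {\<omega> \<in> space M. X t \<omega> u \<noteq> X t \<omega> v}
        = prob {\<omega> \<in> space M. X t \<omega> u = X t \<omega> v}"
      using eventually_ge_at_top[of 0]
    proof eventually_elim
      case (elim t)
      note [measurable] = site_sets[OF elim]
      have "{\<omega> \<in> space M. X t \<omega> u = X t \<omega> v} \<in> events" by measurable
      from prob_neg[OF this] show ?case by simp
    qed
    ultimately show ?thesis by (simp add: filterlim_cong)
  qed
  fix u v
  show "((\<lambda>t. prob {\<omega> \<in> space M. X t \<omega> u = X t \<omega> v}) \<longlongrightarrow> 1) at_top"
    using le[of u v] le[of v u] by (cases "u \<le> v") (simp_all add: eq_commute)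
qed

end

theorem theorem3:
  fixes \<alpha> \<gamma> :: real
    and M :: "'w measure"
    and X :: "real \<Rightarrow> 'w \<Rightarrow> int \<Rightarrow> bool"
  assumes "\<alpha> \<ge> 0" and "\<gamma> \<ge> 0"
    and "cVMBC_Z \<alpha> \<gamma> M X"
    and "starts_with_finitely_many defector M X \<or> starts_with_finitely_many cooperator M X"
  shows "clusters M X
    \<and> (\<alpha> \<ge> \<gamma> \<and> starts_with_finitely_many cooperator M X \<longrightarrow> dies_out cooperator M X)
    \<and> (\<gamma> \<ge> \<alpha> \<and> starts_with_finitely_many defector M X \<longrightarrow> dies_out defector M X)"
proof -
  have "spin_system (cVMBC_rate nn_kernel coop_kernel \<alpha> \<gamma>) M X"
    using assms(3) by (simp add: cVMBC_Z_def)
  then obtain S where prob: "prob_space M" and S: "spin_semigroup (cVMBC_rate nn_kernel coop_kernel \<alpha> \<gamma>) S"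
    and process: "\<forall>t\<ge>0. X t \<in> borel_measurable M" "\<forall>\<omega>\<in>space M. cadlag (\<lambda>t. X t \<omega>)"
      "\<forall>f. \<forall>s\<ge>0. \<forall>t\<ge>0. AE \<omega> in M.
        real_cond_exp M (past M X s) (\<lambda>\<omega>'. apply_bcontfun f (X (s + t) \<omega>')) \<omega>
          = apply_bcontfun (S t f) (X s \<omega>)"
    unfolding spin_system_def by auto
  have start: "\<exists>\<eta>. started_cVMBC \<alpha> \<gamma> S M X \<eta> (\<not> i)" if "starts_with_finitely_many i M X" for i
  proof -
    from that obtain A where A: "finite A" "AE \<omega> in M. X 0 \<omega> = (\<lambda>u. if u \<in> A then i else \<not> i)"
      unfolding starts_with_finitely_many_def by blast
    have "finite {u. (if u \<in> A then i else \<not> i) \<noteq> (\<not> i)}"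
      by (rule finite_subset[OF _ A(1)]) auto
    then show ?thesis
      using assms(1,2) S prob process A(2)
      by (intro exI[of _ "\<lambda>u. if u \<in> A then i else \<not> i"] started_cVMBC.intro cVMBC_flow.intro
          started_cVMBC_axioms.intro) auto
  qed
  have "clusters M X"
    using assms(4) start started_cVMBC.process_clusters by metis
  moreover have "dies_out i M X"
    if "starts_with_finitely_many i M X" "if i then \<gamma> \<le> \<alpha> else \<alpha> \<le> \<gamma>" for i
  proof -
    from start[OF that(1)] obtain \<eta> where "started_cVMBC \<alpha> \<gamma> S M X \<eta> (\<not> i)" by blast
    then interpret started_cVMBC \<alpha> \<gamma> S M X \<eta> "\<not> i" .
    show ?thesis
      unfolding dies_out_def
      using that(2) by (intro allI prob_limit_background) (simp add: background_favored_def split: if_splits)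
  qed
  ultimately show ?thesis by auto
qed

end
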